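(* Let $d\ge 1$ be an integer and $\ell=(\ell_1,\dots,\ell_d)\in\mathbb{Z}_{\ge 0}^d$. Let $f:\mathbb{D}^d\to\mathbb{C}$ and $g=(g_1,\dots,g_d):\mathbb{D}^d\to\mathbb{D}^d$ be analytic functions, and let $W_{f,g}$ be a weighted composition operator on $\mathcal{B}_\ell(\mathbb{D}^d)$ with symbols $f,g$, i.e. a linear operator with $W_{f,g}\preceq W_{f,g,\max}$. If $W_{f,g}$ is real symmetric, then it is complex symmetric.
   Context: $\mathbb{D}=\{z\in\mathbb{C}:|z|<1\}$, and $\mathbb{D}^d$ is the polydisk in $\mathbb{C}^d$. The Bergman space $\mathcal{B}_\ell(\mathbb{D}^d)$ is the Hilbert space of all analytic functions $\xi:\mathbb{D}^d\to\mathbb{C}$ with $$\|\xi\|^2=\int_{\mathbb{D}^d}|\xi(z)|^2\prod_{j=1}^d(1+\ell_j)(1-|z_j|^2)^{\ell_j}\,dA(z_j)<\infty,$$ where $dA$ is the normalized area measure on $\mathbb{D}$. For (possibly unbounded) operators, $A\preceq B$ means $\mathrm{dom}(A)\subseteq\mathrm{dom}(B)$ and $Ax=Bx$ for $x\in\mathrm{dom}(A)$. The maximal weighted composition operator $W_{f,g,\max}$ has domain $\{\xi\in\mathcal{B}_\ell(\mathbb{D}^d): f\cdot(\xi\circ g)\in\mathcal{B}_\ell(\mathbb{D}^d)\}$ and acts by $(W_{f,g,\max}\xi)(z)=f(z)\xi(g(z))$. A (possibly unbounded) linear operator $Q$ is called real symmetric if $Q=Q^*$ (including domains). A conjugation is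 an isometric antilinear involution on the Hilbert space. A (possibly unbounded) linear operator $X$ is called complex symmetric if there exists a conjugation $\mathcal{C}$ such that $X=\mathcal{C}X^*\mathcal{C}$ (including domains). *)

theory Defs
  imports "HOL-Analysis.Analysis"
begin

text \<open>Points of \<open>\<complex>\<^sup>d\<close> are elements of \<^typ>\<open>complex ^ 'n\<close> with \<open>d = CARD('n) \<ge> 1\<close>.\<close>

definition polydisk :: "(complex ^ 'n) set" where
  "polydisk = {z. \<forall>j. cmod (z $ j) < 1}"

text \<open>Holomorphy in several variables: the real Frechet derivative exists and is complex linear.\<close>

definition holomorphic_several_on ::
    "(complex ^ 'n \<Rightarrow> complex) \<Rightarrow> (complex ^ 'n) set \<Rightarrow> bool" where
  "holomorphic_several_on f S \<longleftrightarrow>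
     (\<forall>z\<in>S. \<exists>f'. (f has_derivative f') (at z within S) \<and> (\<forall>c v. f' (c *s v) = c * f' v))"

text \<open>The factor \<open>1 / pi\<close> in each coordinate normalizes the area measure of the unit disk.\<close>

definition bergman_measure :: "('n::finite \<Rightarrow> nat) \<Rightarrow> (complex ^ 'n) measure" where
  "bergman_measure l = density lborel (\<lambda>z. ennreal (indicator polydisk z *
     (\<Prod>j\<in>UNIV. (1 + real (l j)) * (1 - (cmod (z $ j))\<^sup>2) ^ l j * (1 / pi))))"

text \<open>Functions on the polydisk are represented by functions on the whole space that vanish
  outside it, so that equality of functions is equality on the polydisk.\<close>

definition bergman_space :: "('n::finite \<Rightarrow> nat) \<Rightarrow> (complex ^ 'n \<Rightarrow> complex) set" where
  "bergman_space l = {\<xi>. holomorphic_several_on \<xi> polydisk \<and> (\<forall>z. z \<notin> polydisk \<longrightarrow> \<xi> z = 0) \<and>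
     integrable (bergman_measure l) (\<lambda>z. (cmod (\<xi> z))\<^sup>2)}"

definition bergman_inner ::
    "('n::finite \<Rightarrow> nat) \<Rightarrow> (complex ^ 'n \<Rightarrow> complex) \<Rightarrow> (complex ^ 'n \<Rightarrow> complex) \<Rightarrow> complex" where
  "bergman_inner l \<xi> \<eta> = (LINT z|bergman_measure l. \<xi> z * cnj (\<eta> z))"

definition bergman_norm :: "('n::finite \<Rightarrow> nat) \<Rightarrow> (complex ^ 'n \<Rightarrow> complex) \<Rightarrow> real" where
  "bergman_norm l \<xi> = sqrt (LINT z|bergman_measure l. (cmod (\<xi> z))\<^sup>2)"

text \<open>A possibly unbounded operator is a partial map. Equality of partial maps includes equality
  of the domains, and \<open>A \<subseteq>\<^sub>m B\<close> says that \<open>B\<close> extends \<open>A\<close>.\<close>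

type_synonym 'n partial_op = "(complex ^ 'n \<Rightarrow> complex) \<rightharpoonup> (complex ^ 'n \<Rightarrow> complex)"

definition linear_operator :: "('n::finite \<Rightarrow> nat) \<Rightarrow> 'n partial_op \<Rightarrow> bool" where
  "linear_operator l T \<longleftrightarrow>
     dom T \<subseteq> bergman_space l \<and> ran T \<subseteq> bergman_space l \<and> (\<lambda>z. 0) \<in> dom T \<and>
     (\<forall>\<xi>\<in>dom T. \<forall>\<eta>\<in>dom T. \<forall>a b.
        T (\<lambda>z. a * \<xi> z + b * \<eta> z) = Some (\<lambda>z. a * the (T \<xi>) z + b * the (T \<eta>) z))"

definition densely_defined :: "('n::finite \<Rightarrow> nat) \<Rightarrow> 'n partial_op \<Rightarrow> bool" where
  "densely_defined l T \<longleftrightarrow>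
     (\<forall>\<xi>\<in>bergman_space l. \<forall>\<epsilon>>0. \<exists>\<eta>\<in>dom T. bergman_norm l (\<lambda>z. \<xi> z - \<eta> z) < \<epsilon>)"

definition is_adjoint_value ::
    "('n::finite \<Rightarrow> nat) \<Rightarrow> 'n partial_op \<Rightarrow> (complex ^ 'n \<Rightarrow> complex) \<Rightarrow> (complex ^ 'n \<Rightarrow> complex) \<Rightarrow> bool" where
  "is_adjoint_value l T \<eta> \<zeta> \<longleftrightarrow> \<zeta> \<in> bergman_space l \<and>
     (\<forall>\<xi>\<in>dom T. bergman_inner l (the (T \<xi>)) \<eta> = bergman_inner l \<xi> \<zeta>)"

text \<open>The value of the adjoint is unique, and the adjoint hence meaningful, only for densely
  defined operators; its uses below therefore include density.\<close>

definition adjoint_op :: "('n::finite \<Rightarrow> nat) \<Rightarrow> 'n partial_op \<Rightarrow> 'n partial_op" where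
  "adjoint_op l T = (\<lambda>\<eta>. if \<eta> \<in> bergman_space l \<and> (\<exists>\<zeta>. is_adjoint_value l T \<eta> \<zeta>)
     then Some (THE \<zeta>. is_adjoint_value l T \<eta> \<zeta>) else None)"

definition real_symmetric :: "('n::finite \<Rightarrow> nat) \<Rightarrow> 'n partial_op \<Rightarrow> bool" where
  "real_symmetric l Q \<longleftrightarrow> densely_defined l Q \<and> Q = adjoint_op l Q"

definition conjugation ::
    "('n::finite \<Rightarrow> nat) \<Rightarrow> ((complex ^ 'n \<Rightarrow> complex) \<Rightarrow> (complex ^ 'n \<Rightarrow> complex)) \<Rightarrow> bool" where
  "conjugation l C \<longleftrightarrow>
     (\<forall>\<xi>\<in>bergman_space l. C \<xi> \<in> bergman_space l \<and> C (C \<xi>) = \<xi> \<and>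
        bergman_norm l (C \<xi>) = bergman_norm l \<xi>) \<and>
     (\<forall>\<xi>\<in>bergman_space l. \<forall>\<eta>\<in>bergman_space l. \<forall>a b.
        C (\<lambda>z. a * \<xi> z + b * \<eta> z) = (\<lambda>z. cnj a * C \<xi> z + cnj b * C \<eta> z))"

text \<open>The operator \<open>C T C\<close>, whose domain consists of the \<open>\<xi>\<close> in the Bergman space with
  \<open>C \<xi> \<in> dom T\<close>.\<close>

definition conjugate_op ::
    "('n::finite \<Rightarrow> nat) \<Rightarrow> ((complex ^ 'n \<Rightarrow> complex) \<Rightarrow> (complex ^ 'n \<Rightarrow> complex)) \<Rightarrow>
      'n partial_op \<Rightarrow> 'n partial_op" where
  "conjugate_op l C T = (\<lambda>\<xi>. if \<xi> \<in> bergman_space l then map_option C (T (C \<xi>)) else None)"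

definition complex_symmetric :: "('n::finite \<Rightarrow> nat) \<Rightarrow> 'n partial_op \<Rightarrow> bool" where
  "complex_symmetric l X \<longleftrightarrow> densely_defined l X \<and>
     (\<exists>C. conjugation l C \<and> X = conjugate_op l C (adjoint_op l X))"

definition weighted_composition ::
    "(complex ^ 'n \<Rightarrow> complex) \<Rightarrow> (complex ^ 'n \<Rightarrow> complex ^ 'n) \<Rightarrow>
      (complex ^ 'n \<Rightarrow> complex) \<Rightarrow> (complex ^ 'n \<Rightarrow> complex)" where
  "weighted_composition f g \<xi> = (\<lambda>z. if z \<in> polydisk then f z * \<xi> (g z) else 0)"

definition W_max ::
    "('n::finite \<Rightarrow> nat) \<Rightarrow> (complex ^ 'n \<Rightarrow> complex) \<Rightarrow> (complex ^ 'n \<Rightarrow> complex ^ 'n) \<Rightarrow> 'n partial_op" where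
  "W_max l f g = (\<lambda>\<xi>. if \<xi> \<in> bergman_space l \<and> weighted_composition f g \<xi> \<in> bergman_space l
     then Some (weighted_composition f g \<xi>) else None)"

end

theory Submission
  imports Defs "HOL-Complex_Analysis.Complex_Analysis" "HOL-Library.Function_Algebras"
begin

text \<open>Every self-adjoint operator \<open>W\<close> on a Hilbert space is complex symmetric. Its resolvents
  \<open>R = (W - \<i>)\<inverse>\<close> and \<open>R' = (W + \<i>)\<inverse>\<close> are commuting contractions adjoint to each other, and a
  conjugation \<open>C\<close> with \<open>C R = R' C\<close> satisfies \<open>C W C = W\<close>. By Zorn's lemma there is a maximal
  isometric antilinear involution with this intertwining property on a subspace invariant under
  \<open>R\<close> and \<open>R'\<close>. Its domain is closed, and a nonzero vector \<open>v\<close> orthogonal to it would give the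
  extension \<open>p(R, R') v \<mapsto> p(R, R')\<^sup>* v\<close>, which is isometric because the polynomials \<open>p(R, R')\<close> are normal.

  Orthogonal projections need the Bergman space to be complete. Point evaluations are locally
  bounded by the mean value inequality, so Cauchy sequences converge locally uniformly together with
  their derivatives by Cauchy's estimates, and Fatou's lemma gives convergence in norm.\<close>

section \<open>Hilbert spaces as subspaces\<close>

text \<open>In the spectral picture the cyclic subspace of v under R and R' is an L^2 space in which
  v is the constant 1 and R is multiplication by a function; the map used for the extension is then
  pointwise complex conjugation. Working with the polynomials themselves replaces the spectral
  measure: equality of the norms of p v and p^* v makes the map isometric and, for the same reason,
  well defined. Resolvents enter because W is unbounded: powers of W need not exist on an arbitrary
  vector, whereas polynomials in R and R' act on the whole space. The points \<open>\<i>\<close> and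
  \<open>- \<i>\<close> are convenient because symmetry of W gives |(W - c) x|^2 = |W x|^2 + |x|^2
  for both, which yields injectivity, a closed range and the norm bound 1 of the inverse at once.
  Conjugations and the operator are treated as sets of pairs: inclusion of graphs is the order for
  Zorn's lemma, and self-adjointness becomes a single equivalence. Since the Bergman space is a set
  of functions rather than a type, all Hilbert space notions are relative to a carrier
  \<open>H\<close>.\<close>

locale inner_product_subspace = vector_space scale
  for scale :: "complex \<Rightarrow> 'v::ab_group_add \<Rightarrow> 'v" (infixr \<open>*\<^sub>C\<close> 75) +
  fixes H :: "'v set" and ip :: "'v \<Rightarrow> 'v \<Rightarrow> complex"
  assumes subspace_H: "subspace H"
    and ip_add_left: "\<lbrakk>x \<in> H; y \<in> H; z \<in> H\<rbrakk> \<Longrightarrow> ip (x + y) z = ip x z + ip y z"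
    and ip_scale_left: "\<lbrakk>x \<in> H; y \<in> H\<rbrakk> \<Longrightarrow> ip (c *\<^sub>C x) y = c * ip x y"
    and ip_commute: "\<lbrakk>x \<in> H; y \<in> H\<rbrakk> \<Longrightarrow> ip y x = cnj (ip x y)"
    and ip_self_nonneg: "x \<in> H \<Longrightarrow> 0 \<le> Re (ip x x)"
    and ip_definite: "\<lbrakk>x \<in> H; ip x x = 0\<rbrakk> \<Longrightarrow> x = 0"
begin

definition nrm :: "'v \<Rightarrow> real" where
  "nrm x = sqrt (Re (ip x x))"

lemma H_closed [simp, intro]:
  shows "0 \<in> H"
    and "\<lbrakk>x \<in> H; y \<in> H\<rbrakk> \<Longrightarrow> x + y \<in> H"
    and "\<lbrakk>x \<in> H; y \<in> H\<rbrakk> \<Longrightarrow> x - y \<in> H"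
    and "x \<in> H \<Longrightarrow> - x \<in> H"
    and "x \<in> H \<Longrightarrow> c *\<^sub>C x \<in> H"
  by (fact subspace_0[OF subspace_H] subspace_add[OF subspace_H] subspace_diff[OF subspace_H]
      subspace_neg[OF subspace_H] subspace_scale[OF subspace_H])+

lemma ip_add_right: "\<lbrakk>x \<in> H; y \<in> H; z \<in> H\<rbrakk> \<Longrightarrow> ip z (x + y) = ip z x + ip z y"
  using ip_commute[of "x + y" z] ip_commute[of x z] ip_commute[of y z] by (simp add: ip_add_left)

lemma ip_scale_right: "\<lbrakk>x \<in> H; y \<in> H\<rbrakk> \<Longrightarrow> ip x (c *\<^sub>C y) = cnj c * ip x y"
  using ip_commute[of "c *\<^sub>C y" x] ip_commute[of y x] by (simp add: ip_scale_left)

lemma ip_minus_left: "\<lbrakk>x \<in> H; y \<in> H\<rbrakk> \<Longrightarrow> ip (- x) y = - ip x y"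
  using ip_scale_left[of x y "- 1"] by simp

lemma ip_minus_right: "\<lbrakk>x \<in> H; y \<in> H\<rbrakk> \<Longrightarrow> ip x (- y) = - ip x y"
  using ip_scale_right[of x y "- 1"] by simp

lemma ip_diff_left: "\<lbrakk>x \<in> H; y \<in> H; z \<in> H\<rbrakk> \<Longrightarrow> ip (x - y) z = ip x z - ip y z"
  using ip_add_left[of x "- y" z] by (simp add: ip_minus_left)

lemma ip_diff_right: "\<lbrakk>x \<in> H; y \<in> H; z \<in> H\<rbrakk> \<Longrightarrow> ip z (x - y) = ip z x - ip z y"
  using ip_add_right[of x "- y" z] by (simp add: ip_minus_right)

lemma ip_ext: "\<lbrakk>x \<in> H; y \<in> H; \<And>z. z \<in> H \<Longrightarrow> ip x z = ip y z\<rbrakk> \<Longrightarrow> x = y"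
  using ip_definite[of "x - y"] by (simp add: ip_diff_left)

lemma ip_zero [simp]: "x \<in> H \<Longrightarrow> ip 0 x = 0" "x \<in> H \<Longrightarrow> ip x 0 = 0"
  using ip_scale_left[of x x 0] ip_scale_right[of x x 0] by simp_all

lemmas ip_simps = ip_add_left ip_add_right ip_scale_left ip_scale_right
  ip_minus_left ip_minus_right ip_diff_left ip_diff_right

lemma ip_self_of_real: "x \<in> H \<Longrightarrow> ip x x = of_real ((nrm x)\<^sup>2)"
  using arg_cong[OF ip_commute[of x x], of Im] ip_self_nonneg[of x]
  by (simp add: nrm_def complex_eq_iff)

lemma nrm_nonneg [simp]: "x \<in> H \<Longrightarrow> 0 \<le> nrm x"
  by (simp add: nrm_def ip_self_nonneg)

lemma nrm_sq: "x \<in> H \<Longrightarrow> (nrm x)\<^sup>2 = Re (ip x x)"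
  by (simp add: nrm_def ip_self_nonneg)

lemma nrm_zero [simp]: "nrm 0 = 0"
  by (simp add: nrm_def)

lemma nrm_eq_0_iff: "x \<in> H \<Longrightarrow> nrm x = 0 \<longleftrightarrow> x = 0"
  using ip_self_of_real ip_definite by fastforce

lemma nrm_eqI: "\<lbrakk>x \<in> H; y \<in> H; ip x x = ip y y\<rbrakk> \<Longrightarrow> nrm x = nrm y"
  by (simp add: nrm_def)

lemma nrm_scale: "x \<in> H \<Longrightarrow> nrm (c *\<^sub>C x) = cmod c * nrm x"
proof -
  assume x: "x \<in> H"
  have "ip (c *\<^sub>C x) (c *\<^sub>C x) = (c * cnj c) * ip x x"
    using x by (simp add: ip_simps)
  then have "Re (ip (c *\<^sub>C x) (c *\<^sub>C x)) = (cmod c)\<^sup>2 * Re (ip x x)"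
    unfolding complex_norm_square[symmetric] by simp
  then show ?thesis
    by (simp add: nrm_def real_sqrt_mult)
qed

lemma nrm_minus: "x \<in> H \<Longrightarrow> nrm (- x) = nrm x"
  using nrm_scale[of x "- 1"] by simp

lemma nrm_minus_commute: "\<lbrakk>x \<in> H; y \<in> H\<rbrakk> \<Longrightarrow> nrm (x - y) = nrm (y - x)"
  using nrm_minus[of "x - y"] by simp

lemma nrm_add_sq: "\<lbrakk>x \<in> H; y \<in> H\<rbrakk> \<Longrightarrow> (nrm (x + y))\<^sup>2 = (nrm x)\<^sup>2 + 2 * Re (ip x y) + (nrm y)\<^sup>2"
  using ip_commute[of x y] by (simp add: nrm_sq ip_simps)

lemma nrm_diff_sq: "\<lbrakk>x \<in> H; y \<in> H\<rbrakk> \<Longrightarrow> (nrm (x - y))\<^sup>2 = (nrm x)\<^sup>2 - 2 * Re (ip x y) + (nrm y)\<^sup>2"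
  using ip_commute[of x y] by (simp add: nrm_sq ip_simps)

lemma parallelogram:
  "\<lbrakk>x \<in> H; y \<in> H\<rbrakk> \<Longrightarrow> (nrm (x + y))\<^sup>2 + (nrm (x - y))\<^sup>2 = 2 * (nrm x)\<^sup>2 + 2 * (nrm y)\<^sup>2"
  by (simp add: nrm_add_sq nrm_diff_sq)

text \<open>Pythagoras: the subtracted multiple of \<open>y\<close> is the orthogonal projection of
  \<open>x\<close> on its line. The exact gain gives both the Cauchy-Schwarz inequality and the
  orthogonality of a nearest point.\<close>

lemma nrm_diff_projection:
  assumes "x \<in> H" "y \<in> H" "y \<noteq> 0"
  shows "(nrm (x - (ip x y / of_real ((nrm y)\<^sup>2)) *\<^sub>C y))\<^sup>2 = (nrm x)\<^sup>2 - (cmod (ip x y))\<^sup>2 / (nrm y)\<^sup>2"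
proof -
  define a where "a = ip x y"
  define n where "n = (nrm y)\<^sup>2"
  have n: "n \<noteq> 0"
    using assms nrm_eq_0_iff by (simp add: n_def)
  have "Re (ip x ((a / of_real n) *\<^sub>C y)) = (cmod a)\<^sup>2 / n"
    using assms by (simp add: ip_simps a_def[symmetric] cmod_power2)
      (simp add: power2_eq_square add_divide_distrib)
  moreover have "(nrm ((a / of_real n) *\<^sub>C y))\<^sup>2 = (cmod a)\<^sup>2 / n"
    using n assms by (simp add: nrm_scale power_mult_distrib power_divide norm_divide flip: n_def)
      (simp add: power2_eq_square)
  ultimately show ?thesis
    using assms by (simp add: nrm_diff_sq flip: a_def n_def)
qed

lemma Cauchy_Schwarz: "\<lbrakk>x \<in> H; y \<in> H\<rbrakk> \<Longrightarrow> cmod (ip x y) \<le> nrm x * nrm y"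
proof (cases "y = 0")
  case False
  assume xy: "x \<in> H" "y \<in> H"
  then have n: "nrm y > 0"
    using False nrm_eq_0_iff nrm_nonneg by (metis order_le_less)
  have "(cmod (ip x y))\<^sup>2 / (nrm y)\<^sup>2 \<le> (nrm x)\<^sup>2"
    using nrm_diff_projection[OF xy False] by (metis diff_ge_0_iff_ge zero_le_power2)
  then have "(cmod (ip x y))\<^sup>2 \<le> (nrm x * nrm y)\<^sup>2"
    using n by (simp add: field_simps)
  then show ?thesis
    by (rule power2_le_imp_le) (use xy in simp)
qed simp

lemma nrm_triangle: "\<lbrakk>x \<in> H; y \<in> H\<rbrakk> \<Longrightarrow> nrm (x + y) \<le> nrm x + nrm y"
proof (rule power2_le_imp_le)
  assume xy: "x \<in> H" "y \<in> H"
  then show "(nrm (x + y))\<^sup>2 \<le> (nrm x + nrm y)\<^sup>2"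
    using Cauchy_Schwarz[OF xy] complex_Re_le_cmod[of "ip x y"]
    by (simp add: nrm_add_sq power2_sum)
qed simp

lemma nrm_triangle_diff: "\<lbrakk>x \<in> H; y \<in> H; z \<in> H\<rbrakk> \<Longrightarrow> nrm (x - z) \<le> nrm (x - y) + nrm (y - z)"
  using nrm_triangle[of "x - y" "y - z"] by simp

lemma nrm_le_diff: "\<lbrakk>x \<in> H; y \<in> H\<rbrakk> \<Longrightarrow> nrm x \<le> nrm y + nrm (x - y)"
  using nrm_triangle[of y "x - y"] by simp

end

locale complex_hilbert = inner_product_subspace +
  assumes complete:
    "\<lbrakk>\<And>n. X n \<in> H; \<And>e. e > 0 \<Longrightarrow> \<exists>N. \<forall>m\<ge>N. \<forall>n\<ge>N. nrm (X m - X n) < e\<rbrakk>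
      \<Longrightarrow> \<exists>x\<in>H. (\<lambda>n. nrm (X n - x)) \<longlonglongrightarrow> 0"
begin

text \<open>The projection argument: a minimizing sequence for the distance from \<open>h\<close> to
  \<open>M\<close> converges to some \<open>p\<close> in \<open>M\<close>, and \<open>h - p\<close>
  is orthogonal to \<open>M\<close>, hence zero. Closedness is phrased as approximability by vectors
  of \<open>M\<close>, the form that domains and ranges supply later.\<close>

lemma closed_subspace_eq_H:
  assumes M: "subspace M" "M \<subseteq> H"
    and closed: "\<And>x. \<lbrakk>x \<in> H; \<And>e. e > 0 \<Longrightarrow> \<exists>u\<in>M. nrm (x - u) < e\<rbrakk> \<Longrightarrow> x \<in> M"
    and orth: "\<And>x. \<lbrakk>x \<in> H; \<And>m. m \<in> M \<Longrightarrow> ip x m = 0\<rbrakk> \<Longrightarrow> x = 0"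
  shows "M = H"
proof (intro equalityI M subsetI)
  fix h assume h: "h \<in> H"
  define d where "d = Inf ((\<lambda>m. nrm (h - m)) ` M)"
  have MH: "m \<in> H" if "m \<in> M" for m using that M by blast
  have M0: "M \<noteq> {}" using M subspace_0 by blast
  have bdd: "bdd_below ((\<lambda>m. nrm (h - m)) ` M)"
    by (rule bdd_belowI[of _ 0]) (use h MH in auto)
  have d_le: "d \<le> nrm (h - m)" if "m \<in> M" for m
    unfolding d_def using that bdd by (auto intro: cInf_lower)
  have d0: "0 \<le> d"
    unfolding d_def by (rule cInf_greatest) (use M0 h MH in auto)
  have "\<exists>m\<in>M. nrm (h - m) < d + inverse (real (Suc n))" for n
    using cInf_lessD[of "(\<lambda>m. nrm (h - m)) ` M" "d + inverse (real (Suc n))"] M0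
    by (auto simp flip: d_def)
  then obtain X where XM: "\<And>n. X n \<in> M"
    and X: "\<And>n. nrm (h - X n) < d + inverse (real (Suc n))"
    by metis
  have XH: "X n \<in> H" for n using XM MH by blast
  \<comment> \<open>The midpoint of \<open>X m\<close> and \<open>X n\<close> lies in
    \<open>M\<close>, so it is no closer to \<open>h\<close> than \<open>d\<close>. The
    parallelogram law then leaves at most 4 (d + e)^2 - 4 d^2 for the squared difference.\<close>
  have step: "(nrm (X m - X n))\<^sup>2 \<le> 8 * d * e + 4 * e\<^sup>2"
    if "inverse (real (Suc m)) \<le> e" "inverse (real (Suc n)) \<le> e" for m n e
  proof -
    have e: "e > 0"
      using that(1) by (rule less_le_trans[rotated]) simp
    have *: "(nrm (h - X k))\<^sup>2 \<le> (d + e)\<^sup>2" if "inverse (real (Suc k)) \<le> e" for k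
      by (rule power_mono) (use X[of k] that h XH in auto)
    have mid: "(1/2) *\<^sub>C (X m + X n) \<in> M"
      using XM M subspace_add subspace_scale by blast
    have "2 *\<^sub>C (h - (1/2) *\<^sub>C (X m + X n)) = 2 *\<^sub>C h - (X m + X n)"
      by (simp add: scale_right_diff_distrib)
    also have "2 *\<^sub>C h = h + h"
      using scale_left_distrib[of 1 1 h] by simp
    finally have "(h - X m) + (h - X n) = 2 *\<^sub>C (h - (1/2) *\<^sub>C (X m + X n))"
      by (simp add: algebra_simps del: scale_left_distrib scale_right_distrib scale_scale)
    then have "nrm ((h - X m) + (h - X n)) = 2 * nrm (h - (1/2) *\<^sub>C (X m + X n))"
      using h XH by (simp add: nrm_scale)
    then have "nrm ((h - X m) + (h - X n)) \<ge> 2 * d"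
      using d_le[OF mid] by simp
    then have "(nrm ((h - X m) + (h - X n)))\<^sup>2 \<ge> (2 * d)\<^sup>2"
      using d0 by (intro power_mono) auto
    moreover have "(nrm ((h - X m) - (h - X n)))\<^sup>2 = (nrm (X m - X n))\<^sup>2"
      using nrm_minus_commute[OF XH XH, of n m] by simp
    moreover have "(nrm ((h - X m) + (h - X n)))\<^sup>2 + (nrm ((h - X m) - (h - X n)))\<^sup>2
        = 2 * (nrm (h - X m))\<^sup>2 + 2 * (nrm (h - X n))\<^sup>2"
      by (rule parallelogram) (use h XH in auto)
    ultimately have "(nrm (X m - X n))\<^sup>2 \<le> 4 * (d + e)\<^sup>2 - (2 * d)\<^sup>2"
      using *[OF that(1)] *[OF that(2)] by linarith
    also have "\<dots> = 8 * d * e + 4 * e\<^sup>2"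
      by (simp add: power2_eq_square algebra_simps)
    finally show ?thesis .
  qed
  have "\<exists>N. \<forall>m\<ge>N. \<forall>n\<ge>N. nrm (X m - X n) < e" if e: "e > 0" for e
  proof -
    have "((\<lambda>n. 8 * d * inverse (real (Suc n)) + 4 * (inverse (real (Suc n)))\<^sup>2) \<longlongrightarrow> 8 * d * 0 + 4 * 0\<^sup>2) sequentially"
      by (intro tendsto_intros LIMSEQ_inverse_real_of_nat)
    then have "\<forall>\<^sub>F n in sequentially. 8 * d * inverse (real (Suc n)) + 4 * (inverse (real (Suc n)))\<^sup>2 < e\<^sup>2"
      by (rule order_tendstoD) (use e in simp)
    then obtain N where N: "8 * d * inverse (real (Suc N)) + 4 * (inverse (real (Suc N)))\<^sup>2 < e\<^sup>2"
      unfolding eventually_sequentially by blast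
    have "nrm (X m - X n) < e" if "m \<ge> N" "n \<ge> N" for m n
    proof (rule power_less_imp_less_base[of _ 2])
      show "(nrm (X m - X n))\<^sup>2 < e\<^sup>2"
        using step[of m "inverse (real (Suc N))" n] that N by (simp add: le_imp_inverse_le)
    qed (use e in simp)
    then show ?thesis by blast
  qed
  then obtain p where p: "p \<in> H" and lim: "(\<lambda>n. nrm (X n - p)) \<longlonglongrightarrow> 0"
    using complete[of X] XH by blast
  have pM: "p \<in> M"
  proof (rule closed[OF p])
    fix e :: real assume "e > 0"
    then have "\<forall>\<^sub>F n in sequentially. nrm (X n - p) < e"
      using lim order_tendstoD(2) by blast
    then obtain n where "nrm (X n - p) < e"
      unfolding eventually_sequentially by blast
    then show "\<exists>u\<in>M. nrm (p - u) < e"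
      using nrm_minus_commute[OF p XH] XM by metis
  qed
  have hp: "nrm (h - p) \<le> d"
  proof (rule LIMSEQ_le_const)
    have "(\<lambda>n. (d + inverse (real (Suc n))) + nrm (X n - p)) \<longlonglongrightarrow> (d + 0) + 0"
      by (intro tendsto_intros lim LIMSEQ_inverse_real_of_nat)
    then show "(\<lambda>n. (d + inverse (real (Suc n))) + nrm (X n - p)) \<longlonglongrightarrow> d"
      by simp
    have "nrm (h - p) \<le> (d + inverse (real (Suc n))) + nrm (X n - p)" for n
      using nrm_triangle_diff[OF h XH p, of n] X[of n] by linarith
    then show "\<exists>N. \<forall>n\<ge>N. nrm (h - p) \<le> (d + inverse (real (Suc n))) + nrm (X n - p)"
      by blast
  qed
  have "ip (h - p) m = 0" if m: "m \<in> M" for m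
  proof (cases "m = 0")
    case False
    \<comment> \<open>Moving \<open>p\<close> by the projection coefficient would shorten the
      distance strictly unless the inner product vanishes.\<close>
    define t where "t = ip (h - p) m / of_real ((nrm m)\<^sup>2)"
    have "p + t *\<^sub>C m \<in> M"
      using pM m M subspace_add subspace_scale by blast
    from d_le[OF this] have "d \<le> nrm ((h - p) - t *\<^sub>C m)"
      by (simp add: diff_diff_eq)
    then have "(nrm (h - p))\<^sup>2 \<le> (nrm ((h - p) - t *\<^sub>C m))\<^sup>2"
      using hp h p by (intro power_mono) auto
    also have "\<dots> = (nrm (h - p))\<^sup>2 - (cmod (ip (h - p) m))\<^sup>2 / (nrm m)\<^sup>2"
      unfolding t_def by (rule nrm_diff_projection) (use h p m MH False in auto)
    finally have "(cmod (ip (h - p) m))\<^sup>2 / (nrm m)\<^sup>2 \<le> 0"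
      by simp
    moreover have "(nrm m)\<^sup>2 > 0"
      using False MH[OF m] nrm_eq_0_iff[of m] by simp
    ultimately show ?thesis
      by (simp add: divide_le_0_iff)
  qed (use h p in simp)
  then have "h - p = 0"
    using orth[of "h - p"] h p by blast
  then show "h \<in> M" using pM by simp
qed

end


section \<open>Conjugations intertwining a normal contraction and its adjoint\<close>

text \<open>\<open>R'\<close> is the adjoint of \<open>R\<close>, and \<open>commute\<close> is
  normality. The norm bound supplies the continuity with which the intertwining relation passes to
  closures of graphs.\<close>

locale normal_contraction = complex_hilbert +
  fixes R R' :: "'a \<Rightarrow> 'a"
  assumes R_H [simp, intro]: "x \<in> H \<Longrightarrow> R x \<in> H"
    and R'_H [simp, intro]: "x \<in> H \<Longrightarrow> R' x \<in> H"
    and adjoint: "\<lbrakk>x \<in> H; y \<in> H\<rbrakk> \<Longrightarrow> ip (R x) y = ip x (R' y)"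
    and commute: "x \<in> H \<Longrightarrow> R (R' x) = R' (R x)"
    and contraction: "x \<in> H \<Longrightarrow> nrm (R x) \<le> nrm x"
begin

lemma adjoint': "\<lbrakk>x \<in> H; y \<in> H\<rbrakk> \<Longrightarrow> ip (R' x) y = ip x (R y)"
  using ip_commute[of "R y" x] ip_commute[of y "R' x"] adjoint[of y x] by simp

text \<open>Linearity is a consequence of having an adjoint: moving \<open>R\<close> across shows
  that both sides have the same inner product with every vector of \<open>H\<close>.\<close>

lemma R_add: "\<lbrakk>x \<in> H; y \<in> H\<rbrakk> \<Longrightarrow> R (x + y) = R x + R y"
  by (rule ip_ext) (auto simp: adjoint ip_simps)

lemma R_scale: "x \<in> H \<Longrightarrow> R (c *\<^sub>C x) = c *\<^sub>C R x"
  by (rule ip_ext) (auto simp: adjoint ip_simps)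

lemma R'_add: "\<lbrakk>x \<in> H; y \<in> H\<rbrakk> \<Longrightarrow> R' (x + y) = R' x + R' y"
  by (rule ip_ext) (auto simp: adjoint' ip_simps)

lemma R'_scale: "x \<in> H \<Longrightarrow> R' (c *\<^sub>C x) = c *\<^sub>C R' x"
  by (rule ip_ext) (auto simp: adjoint' ip_simps)

lemma R_diff: "\<lbrakk>x \<in> H; y \<in> H\<rbrakk> \<Longrightarrow> R (x - y) = R x - R y"
  by (rule ip_ext) (auto simp: adjoint ip_simps)

lemma R'_diff: "\<lbrakk>x \<in> H; y \<in> H\<rbrakk> \<Longrightarrow> R' (x - y) = R' x - R' y"
  by (rule ip_ext) (auto simp: adjoint' ip_simps)

text \<open>By normality \<open>R x\<close> and \<open>R' x\<close> are equally long: both squared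
  norms equal the inner product of \<open>x\<close> with \<open>R' (R x)\<close>.\<close>

lemma contraction': "x \<in> H \<Longrightarrow> nrm (R' x) \<le> nrm x"
proof -
  assume x: "x \<in> H"
  have "(nrm (R' x))\<^sup>2 = (nrm (R x))\<^sup>2"
    using x by (simp add: nrm_sq adjoint adjoint' commute)
  then have "nrm (R' x) = nrm (R x)"
    using x by simp
  with contraction[OF x] show ?thesis by simp
qed

section \<open>Polynomials in a normal operator and its adjoint\<close>

text \<open>Each polynomial p(R, R') is carried together with its adjoint, so that inductions treat
  the two at once. Multiplying on the left by \<open>R\<close> or \<open>R'\<close> is enough to
  reach all polynomials.\<close>

inductive_set star_algebra :: "(('a \<Rightarrow> 'a) \<times> ('a \<Rightarrow> 'a)) set" where
  one: "((\<lambda>x. x), (\<lambda>x. x)) \<in> star_algebra"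
| R: "(A, B) \<in> star_algebra \<Longrightarrow> ((\<lambda>x. R (A x)), (\<lambda>x. R' (B x))) \<in> star_algebra"
| R': "(A, B) \<in> star_algebra \<Longrightarrow> ((\<lambda>x. R' (A x)), (\<lambda>x. R (B x))) \<in> star_algebra"
| add: "\<lbrakk>(A, B) \<in> star_algebra; (A', B') \<in> star_algebra\<rbrakk> \<Longrightarrow>
    ((\<lambda>x. A x + A' x), (\<lambda>x. B x + B' x)) \<in> star_algebra"
| scale: "(A, B) \<in> star_algebra \<Longrightarrow> ((\<lambda>x. c *\<^sub>C A x), (\<lambda>x. cnj c *\<^sub>C B x)) \<in> star_algebra"

lemma star_algebra_swap: "(A, B) \<in> star_algebra \<Longrightarrow> (B, A) \<in> star_algebra"
proof (induction rule: star_algebra.induct)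
  case (scale A B c)
  then show ?case
    using star_algebra.scale[of B A "cnj c"] by simp
qed (auto intro: star_algebra.intros)

lemma star_algebra_H:
  "(A, B) \<in> star_algebra \<Longrightarrow> x \<in> H \<Longrightarrow> A x \<in> H \<and> B x \<in> H"
  by (induction arbitrary: x rule: star_algebra.induct) auto

lemma star_algebra_linear:
  assumes "(A, B) \<in> star_algebra" "x \<in> H" "y \<in> H"
  shows "A (x + y) = A x + A y" "A (c *\<^sub>C x) = c *\<^sub>C A x"
proof -
  have "A (x + y) = A x + A y \<and> A (c *\<^sub>C x) = c *\<^sub>C A x"
    using assms
    by (induction rule: star_algebra.induct)
      (auto simp: R_add R'_add R_scale R'_scale star_algebra_H scale_right_distrib mult.commute)
  then show "A (x + y) = A x + A y" "A (c *\<^sub>C x) = c *\<^sub>C A x"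
    by auto
qed

lemma star_algebra_commute_R:
  assumes "(A, B) \<in> star_algebra" "x \<in> H"
  shows "A (R x) = R (A x)" "A (R' x) = R' (A x)"
proof -
  have "A (R x) = R (A x) \<and> A (R' x) = R' (A x)"
    using assms
    by (induction rule: star_algebra.induct)
      (auto simp: R_add R'_add R_scale R'_scale star_algebra_H commute)
  then show "A (R x) = R (A x)" "A (R' x) = R' (A x)"
    by auto
qed

lemma star_algebra_commute:
  assumes "(A, B) \<in> star_algebra" "(A', B') \<in> star_algebra" "x \<in> H"
  shows "A (A' x) = A' (A x)"
  using assms(2,3)
proof (induction rule: star_algebra.induct)
  case (R A' B')
  then show ?case using assms(1) by (simp add: star_algebra_commute_R star_algebra_H)
next
  case (R' A' B')
  then show ?case using assms(1) by (simp add: star_algebra_commute_R star_algebra_H)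
next
  case (add A' B' A'' B'')
  then show ?case using assms(1) star_algebra_linear(1)[OF assms(1)] by (simp add: star_algebra_H)
next
  case (scale A' B' c)
  then show ?case using assms(1) star_algebra_linear(2)[OF assms(1)] by (simp add: star_algebra_H)
qed simp

text \<open>The adjoint of the product of \<open>R\<close> and \<open>A\<close> is \<open>B\<close>
  after \<open>R'\<close>, whereas the inductive rule records \<open>R'\<close> after
  \<open>B\<close>; commutation with \<open>R\<close> and \<open>R'\<close> reconciles the
  order.\<close>

lemma star_algebra_adjoint:
  assumes "(A, B) \<in> star_algebra" "x \<in> H" "y \<in> H"
  shows "ip (A x) y = ip x (B y)"
  using assms
proof (induction arbitrary: x y rule: star_algebra.induct)
  case (R A B)
  then show ?case
    by (simp add: star_algebra_H adjoint star_algebra_commute_R(2)[OF star_algebra_swap])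
next
  case (R' A B)
  then show ?case
    by (simp add: star_algebra_H adjoint' star_algebra_commute_R(1)[OF star_algebra_swap])
qed (auto simp: ip_simps star_algebra_H)

text \<open>The polynomials commute with their adjoints, so sending \<open>A v\<close> to
  \<open>B v\<close> preserves norms. This is what makes the map on a cyclic subspace single-valued
  and isometric.\<close>

lemma star_algebra_normal:
  assumes AB: "(A, B) \<in> star_algebra" and x: "x \<in> H"
  shows "nrm (A x) = nrm (B x)"
proof (rule nrm_eqI)
  note BA = star_algebra_swap[OF AB]
  show H: "A x \<in> H" "B x \<in> H"
    using star_algebra_H[OF AB x] by auto
  show "ip (A x) (A x) = ip (B x) (B x)"
    using star_algebra_adjoint[OF AB x H(1)] star_algebra_adjoint[OF BA x H(2)]
      star_algebra_commute[OF AB BA x] by simp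
qed

section \<open>Partially defined conjugations, ordered by inclusion of their graphs\<close>

text \<open>Single-valuedness is derived: the difference of two values at one point is paired with
  0, and paired vectors have equal norm. Symmetry of the graph encodes the involution, and combined
  with the last clause it also gives invariance of the domain under \<open>R'\<close>.\<close>

definition partial_conjugation :: "('a \<times> 'a) set \<Rightarrow> bool" where
  "partial_conjugation G \<longleftrightarrow> G \<subseteq> H \<times> H \<and> (0, 0) \<in> G \<and>
    (\<forall>x y x' y'. (x, y) \<in> G \<longrightarrow> (x', y') \<in> G \<longrightarrow> (x + x', y + y') \<in> G) \<and>
    (\<forall>c x y. (x, y) \<in> G \<longrightarrow> (c *\<^sub>C x, cnj c *\<^sub>C y) \<in> G) \<and>
    (\<forall>x y. (x, y) \<in> G \<longrightarrow> (y, x) \<in> G \<and> nrm x = nrm y \<and> (R x, R' y) \<in> G)"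

lemma partial_conjugationD:
  assumes "partial_conjugation G"
  shows "(x, y) \<in> G \<Longrightarrow> x \<in> H" "(x, y) \<in> G \<Longrightarrow> y \<in> H" "(0, 0) \<in> G"
    "(x, y) \<in> G \<Longrightarrow> (x', y') \<in> G \<Longrightarrow> (x + x', y + y') \<in> G"
    "(x, y) \<in> G \<Longrightarrow> (c *\<^sub>C x, cnj c *\<^sub>C y) \<in> G"
    "(x, y) \<in> G \<Longrightarrow> (y, x) \<in> G" "(x, y) \<in> G \<Longrightarrow> nrm x = nrm y"
    "(x, y) \<in> G \<Longrightarrow> (R x, R' y) \<in> G"
  using assms unfolding partial_conjugation_def by blast+

lemma partial_conjugation_R':
  "\<lbrakk>partial_conjugation G; (x, y) \<in> G\<rbrakk> \<Longrightarrow> (R' x, R y) \<in> G"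
  by (meson partial_conjugationD(6,8))

lemma partial_conjugation_diff:
  assumes "partial_conjugation G" "(x, y) \<in> G" "(x', y') \<in> G"
  shows "(x - x', y - y') \<in> G"
  using partial_conjugationD(4)[OF assms(1,2) partial_conjugationD(5)[OF assms(1,3), of "- 1"]]
  by simp

lemma partial_conjugation_unique:
  assumes G: "partial_conjugation G" and "(x, y) \<in> G" "(x, y') \<in> G"
  shows "y = y'"
proof -
  have "(0, y - y') \<in> G"
    using partial_conjugation_diff[OF assms] by simp
  then have "nrm (y - y') = 0" "y - y' \<in> H"
    using partial_conjugationD(2,7)[OF G] by fastforce+
  then show ?thesis
    using nrm_eq_0_iff by simp
qed

text \<open>All clauses survive limits because the operations involved are continuous,
  \<open>R\<close> and \<open>R'\<close> by contractivity. A maximal graph therefore coincides with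
  its closure.\<close>

lemma partial_conjugation_closure:
  assumes G: "partial_conjugation G"
  defines "K \<equiv> {(x, y). x \<in> H \<and> y \<in> H \<and>
    (\<forall>e>0. \<exists>(u, w)\<in>G. nrm (x - u) < e \<and> nrm (y - w) < e)}"
  shows "partial_conjugation K" "G \<subseteq> K"
proof -
  note D = partial_conjugationD[OF G]
  have KI: "(x, y) \<in> K"
    if "x \<in> H" "y \<in> H" "\<And>e. e > 0 \<Longrightarrow> \<exists>u w. (u, w) \<in> G \<and> nrm (x - u) < e \<and> nrm (y - w) < e" for x y
    using that unfolding K_def by blast
  have KD: "x \<in> H" "y \<in> H" if "(x, y) \<in> K" for x y
    using that unfolding K_def by auto
  have KE: "\<exists>u w. (u, w) \<in> G \<and> u \<in> H \<and> w \<in> H \<and> nrm (x - u) < e \<and> nrm (y - w) < e"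
    if "(x, y) \<in> K" "e > 0" for x y e
    using that D(1,2) unfolding K_def by blast
  show "G \<subseteq> K"
  proof clarify
    fix x y assume "(x, y) \<in> G"
    then show "(x, y) \<in> K"
      by (intro KI exI[of _ x] exI[of _ y]) (auto simp: D)
  qed
  then have "(0, 0) \<in> K"
    using D(3) by blast
  moreover have "(x + x', y + y') \<in> K" if xy: "(x, y) \<in> K" and xy': "(x', y') \<in> K" for x y x' y'
  proof (rule KI)
    fix e :: real assume "e > 0"
    then have e: "e / 2 > 0" by simp
    obtain u w where uw: "(u, w) \<in> G" "u \<in> H" "w \<in> H" "nrm (x - u) < e/2" "nrm (y - w) < e/2"
      using KE[OF xy e] by blast
    obtain u' w' where uw': "(u', w') \<in> G" "u' \<in> H" "w' \<in> H" "nrm (x' - u') < e/2" "nrm (y' - w') < e/2"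
      using KE[OF xy' e] by blast
    have "nrm ((x - u) + (x' - u')) < e" "nrm ((y - w) + (y' - w')) < e"
      using nrm_triangle[of "x - u" "x' - u'"] nrm_triangle[of "y - w" "y' - w'"]
        uw uw' KD[OF xy] KD[OF xy'] by auto
    then have "nrm ((x + x') - (u + u')) < e" "nrm ((y + y') - (w + w')) < e"
      by (simp_all only: add_diff_add)
    then show "\<exists>u w. (u, w) \<in> G \<and> nrm (x + x' - u) < e \<and> nrm (y + y' - w) < e"
      using D(4)[OF uw(1) uw'(1)] by blast
  qed (use KD[OF xy] KD[OF xy'] in auto)
  moreover have "(c *\<^sub>C x, cnj c *\<^sub>C y) \<in> K" if xy: "(x, y) \<in> K" for c x y
  proof (rule KI)
    fix e :: real assume e: "e > 0"
    \<comment> \<open>The summand 1 keeps the divisor positive when \<open>c\<close> is 0.\<close>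
    have "e / (cmod c + 1) > 0"
      using e by (simp add: add_nonneg_pos)
    then obtain u w where uw: "(u, w) \<in> G" "u \<in> H" "w \<in> H"
        "nrm (x - u) < e / (cmod c + 1)" "nrm (y - w) < e / (cmod c + 1)"
      using KE[OF xy] by blast
    have small: "cmod c * r < e" if "r < e / (cmod c + 1)" "0 \<le> r" for r
    proof -
      have "cmod c * r \<le> (cmod c + 1) * r"
        using that by (simp add: algebra_simps)
      also have "\<dots> < e"
        using that(1) by (subst (asm) pos_less_divide_eq) (auto simp: add_nonneg_pos mult.commute)
      finally show ?thesis .
    qed
    have "nrm (c *\<^sub>C (x - u)) < e" "nrm (cnj c *\<^sub>C (y - w)) < e"
      using small[OF uw(4)] small[OF uw(5)] uw KD[OF xy] by (simp_all add: nrm_scale)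
    then show "\<exists>u w. (u, w) \<in> G \<and> nrm (c *\<^sub>C x - u) < e \<and> nrm (cnj c *\<^sub>C y - w) < e"
      using D(5)[OF uw(1), of c] by (metis scale_right_diff_distrib)
  qed (use KD[OF xy] in auto)
  moreover have "(y, x) \<in> K" if "(x, y) \<in> K" for x y
    using KE[OF that] D(6) by (intro KI KD[OF that]) blast
  moreover have "nrm x = nrm y" if xy: "(x, y) \<in> K" for x y
  proof -
    have "\<bar>nrm x - nrm y\<bar> \<le> e" if "e > 0" for e
    proof -
      obtain u w where uw: "(u, w) \<in> G" "u \<in> H" "w \<in> H" "nrm (x - u) < e/2" "nrm (y - w) < e/2"
        using KE[OF xy, of "e/2"] \<open>e > 0\<close> by auto
      have "nrm x \<le> nrm u + nrm (x - u)" "nrm u \<le> nrm x + nrm (x - u)"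
        "nrm y \<le> nrm w + nrm (y - w)" "nrm w \<le> nrm y + nrm (y - w)"
        using nrm_le_diff[of x u] nrm_le_diff[of u x] nrm_le_diff[of y w] nrm_le_diff[of w y]
          nrm_minus_commute[of x u] nrm_minus_commute[of y w] uw KD[OF xy] by auto
      then show ?thesis
        using uw D(7)[OF uw(1)] by linarith
    qed
    then have "\<bar>nrm x - nrm y\<bar> \<le> 0"
      by (rule field_le_epsilon[where y = 0, simplified])
    then show ?thesis by simp
  qed
  moreover have "(R x, R' y) \<in> K" if xy: "(x, y) \<in> K" for x y
  proof (rule KI)
    fix e :: real assume "e > 0"
    then obtain u w where uw: "(u, w) \<in> G" "u \<in> H" "w \<in> H" "nrm (x - u) < e" "nrm (y - w) < e"
      using KE[OF xy] by blast
    have "nrm (R x - R u) < e" "nrm (R' y - R' w) < e"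
      using contraction[of "x - u"] contraction'[of "y - w"] uw KD[OF xy]
      by (auto simp: R_diff R'_diff)
    then show "\<exists>u w. (u, w) \<in> G \<and> nrm (R x - u) < e \<and> nrm (R' y - w) < e"
      using D(8)[OF uw(1)] by blast
  qed (use KD[OF xy] in auto)
  moreover have "K \<subseteq> H \<times> H"
    using KD by auto
  ultimately show "partial_conjugation K"
    unfolding partial_conjugation_def by blast
qed

text \<open>Additivity is the only clause about two pairs, and two members of a chain are
  comparable. Nonemptiness of the chain supplies \<open>(0, 0)\<close>.\<close>

lemma partial_conjugation_Union:
  assumes "\<C> \<noteq> {}" "subset.chain (Collect partial_conjugation) \<C>"
  shows "partial_conjugation (\<Union>\<C>)"
proof -
  have pc: "partial_conjugation G" if "G \<in> \<C>" for G
    using assms(2) that unfolding subset_chain_def by blast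
  have "\<exists>G\<in>\<C>. p \<in> G \<and> q \<in> G" if "p \<in> \<Union>\<C>" "q \<in> \<Union>\<C>" for p q
    using that assms(2) unfolding subset_chain_def by blast
  then have "(x + x', y + y') \<in> \<Union>\<C>" if "(x, y) \<in> \<Union>\<C>" "(x', y') \<in> \<Union>\<C>" for x y x' y'
    using that pc partial_conjugationD(4) by (metis UnionI)
  moreover have "\<Union>\<C> \<subseteq> H \<times> H" "(0, 0) \<in> \<Union>\<C>"
    using pc assms(1) unfolding partial_conjugation_def by blast+
  moreover have "(c *\<^sub>C x, cnj c *\<^sub>C y) \<in> \<Union>\<C>" "(y, x) \<in> \<Union>\<C>" "nrm x = nrm y" "(R x, R' y) \<in> \<Union>\<C>"
    if "(x, y) \<in> \<Union>\<C>" for c x y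
    using that pc partial_conjugationD(5-8) by (metis UnionE UnionI)+
  ultimately show ?thesis
    unfolding partial_conjugation_def by blast
qed

text \<open>The cyclic subspace of \<open>v\<close> is added to the domain of \<open>G\<close>, with
  \<open>v\<close> itself fixed. That domain is invariant under \<open>R\<close> and
  \<open>R'\<close>, so it is orthogonal to every \<open>A v\<close>, not just to \<open>v\<close>;
  norms then split by Pythagoras, and each summand is treated isometrically.\<close>

lemma partial_conjugation_extend:
  assumes G: "partial_conjugation G" and v: "v \<in> H"
    and orth: "\<And>x y. (x, y) \<in> G \<Longrightarrow> ip v x = 0"
  defines "K \<equiv> {(x + A v, y + B v) |x y A B. (x, y) \<in> G \<and> (A, B) \<in> star_algebra}"
  shows "partial_conjugation K" "G \<subseteq> K" "(v, v) \<in> K"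
proof -
  note D = partial_conjugationD[OF G]
  note SH = star_algebra_H[THEN conjunct1, OF _ v] star_algebra_H[THEN conjunct2, OF _ v]
  have KI: "(x + A v, y + B v) \<in> K" if "(x, y) \<in> G" "(A, B) \<in> star_algebra" for x y A B
    using that unfolding K_def by blast
  have KE: "\<exists>a b A B. (a, b) \<in> G \<and> (A, B) \<in> star_algebra \<and> x = a + A v \<and> y = b + B v"
    if "(x, y) \<in> K" for x y
    using that unfolding K_def by blast
  have zero: "((\<lambda>x. 0), (\<lambda>x. 0)) \<in> star_algebra"
    using star_algebra.scale[OF star_algebra.one, of 0] by simp
  show vv: "(v, v) \<in> K"
    using KI[OF D(3) star_algebra.one] by simp
  show GK: "G \<subseteq> K"
    using KI[OF _ zero] by auto
  \<comment> \<open>The induction peels \<open>R\<close> or \<open>R'\<close> off the polynomial and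
    moves its adjoint onto \<open>x\<close>, which stays in the domain of \<open>G\<close>; hence
    \<open>x\<close> and \<open>y\<close> must be arbitrary.\<close>
  have AG: "ip (A v) x = 0" if "(A, B) \<in> star_algebra" "(x, y) \<in> G" for A B x y
    using that
  proof (induction arbitrary: x y rule: star_algebra.induct)
    case (R A B)
    then show ?case
      using R.IH[OF partial_conjugation_R'[OF G R.prems]] D(1)[OF R.prems] by (simp add: adjoint SH)
  next
    case (R' A B)
    then show ?case
      using R'.IH[OF D(8)[OF R'.prems]] D(1)[OF R'.prems] by (simp add: adjoint' SH)
  next
    case (add A B A' B')
    then show ?case
      using add.IH[OF add.prems] D(1)[OF add.prems] by (simp add: ip_simps SH)
  next
    case (scale A B c)
    then show ?case
      using scale.IH[OF scale.prems] D(1)[OF scale.prems] by (simp add: ip_simps SH)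
  qed (simp add: orth)
  have "(x + x', y + y') \<in> K" if "(x, y) \<in> K" "(x', y') \<in> K" for x y x' y'
  proof -
    obtain a b A B where 1: "(a, b) \<in> G" "(A, B) \<in> star_algebra" "x = a + A v" "y = b + B v"
      using KE[OF \<open>(x, y) \<in> K\<close>] by blast
    obtain a' b' A' B' where 2: "(a', b') \<in> G" "(A', B') \<in> star_algebra" "x' = a' + A' v" "y' = b' + B' v"
      using KE[OF \<open>(x', y') \<in> K\<close>] by blast
    show ?thesis
      using KI[OF D(4)[OF 1(1) 2(1)] star_algebra.add[OF 1(2) 2(2)]] 1 2
      by (simp add: ac_simps)
  qed
  moreover have "(c *\<^sub>C x, cnj c *\<^sub>C y) \<in> K" "(y, x) \<in> K" "nrm x = nrm y" "(R x, R' y) \<in> K"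
      "x \<in> H" "y \<in> H"
    if xy: "(x, y) \<in> K" for c x y
  proof -
    obtain a b A B where 1: "(a, b) \<in> G" "(A, B) \<in> star_algebra" "x = a + A v" "y = b + B v"
      using KE[OF xy] by blast
    have H: "a \<in> H" "b \<in> H" "A v \<in> H" "B v \<in> H"
      using D(1,2) SH 1 by blast+
    then show "x \<in> H" "y \<in> H"
      using 1 by auto
    show "(c *\<^sub>C x, cnj c *\<^sub>C y) \<in> K"
      using KI[OF D(5)[OF 1(1)] star_algebra.scale[OF 1(2)], of c] 1
      by (simp add: scale_right_distrib)
    show "(y, x) \<in> K"
      using KI[OF D(6)[OF 1(1)] star_algebra_swap[OF 1(2)]] 1 by simp
    show "(R x, R' y) \<in> K"
      using KI[OF D(8)[OF 1(1)] star_algebra.R[OF 1(2)]] 1 H by (simp add: R_add R'_add)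
    \<comment> \<open>Symmetry of \<open>G\<close> puts \<open>b\<close> into its domain too, so the
      second orthogonality is the first for the swapped pairs.\<close>
    have "ip a (A v) = 0" "ip b (B v) = 0"
      using AG[OF 1(2,1)] AG[OF star_algebra_swap[OF 1(2)] D(6)[OF 1(1)]]
        ip_commute[OF H(3,1)] ip_commute[OF H(4,2)] by auto
    then have "(nrm x)\<^sup>2 = (nrm y)\<^sup>2"
      using 1 H by (simp add: nrm_add_sq D(7)[OF 1(1)] star_algebra_normal[OF 1(2) v])
    then show "nrm x = nrm y"
      using \<open>x \<in> H\<close> \<open>y \<in> H\<close> by simp
  qed
  moreover have "(0, 0) \<in> K"
    using GK D(3) by blast
  ultimately show "partial_conjugation K"
    unfolding partial_conjugation_def by (intro conjI allI impI subrelI SigmaI) simp_all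
qed

theorem conjugation_exists:
  obtains C where
    "\<And>x. x \<in> H \<Longrightarrow> C x \<in> H"
    "\<And>x. x \<in> H \<Longrightarrow> C (C x) = x"
    "\<And>x. x \<in> H \<Longrightarrow> nrm (C x) = nrm x"
    "\<And>x y. \<lbrakk>x \<in> H; y \<in> H\<rbrakk> \<Longrightarrow> C (x + y) = C x + C y"
    "\<And>c x. x \<in> H \<Longrightarrow> C (c *\<^sub>C x) = cnj c *\<^sub>C C x"
    "\<And>x. x \<in> H \<Longrightarrow> C (R x) = R' (C x)"
proof -
  have "partial_conjugation {(0, 0)}"
    using R_scale[of 0 0] R'_scale[of 0 0] unfolding partial_conjugation_def by auto
  then obtain G where G: "partial_conjugation G"
    and max: "\<And>K. \<lbrakk>partial_conjugation K; G \<subseteq> K\<rbrakk> \<Longrightarrow> K = G"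
    using subset_Zorn_nonempty[of "Collect partial_conjugation"] partial_conjugation_Union by blast
  note D = partial_conjugationD[OF G]
  have G_closed: "(x, y) \<in> G"
    if "x \<in> H" "y \<in> H" "\<And>e. e > 0 \<Longrightarrow> \<exists>u w. (u, w) \<in> G \<and> nrm (x - u) < e \<and> nrm (y - w) < e" for x y
    using max[OF partial_conjugation_closure[OF G]] that by blast
  have "Domain G = H"
  proof (rule closed_subspace_eq_H)
    show "subspace (Domain G)"
      unfolding subspace_def using D(3-5) by blast
    show "Domain G \<subseteq> H"
      using D(1) by blast
    show "x = 0" if x: "x \<in> H" and orth: "\<And>m. m \<in> Domain G \<Longrightarrow> ip x m = 0" for x
    proof -
      note E = partial_conjugation_extend[OF G x orth[OF DomainI]]
      \<comment> \<open>The extension already contains \<open>(x, x)\<close>, and maximality absorbs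
        it. Thus \<open>x\<close> lies in the domain to which it is orthogonal.\<close>
      have "(x, x) \<in> G"
        using max[OF E(1,2)] E(3) by simp
      then show ?thesis
        using orth[of x] ip_definite[OF x] by blast
    qed
    \<comment> \<open>A closed isometric graph has closed domain: when the arguments converge, their
      images form a Cauchy sequence, and the pair of limits lies in the graph.\<close>
    show "x \<in> Domain G" if x: "x \<in> H" and near: "\<And>e. e > 0 \<Longrightarrow> \<exists>u\<in>Domain G. nrm (x - u) < e" for x
    proof -
      have "\<exists>u w. (u, w) \<in> G \<and> nrm (x - u) < inverse (real (Suc n))" for n
        using near[of "inverse (real (Suc n))"] by auto
      then obtain U Y where UY: "\<And>n. (U n, Y n) \<in> G"
        and U: "\<And>n. nrm (x - U n) < inverse (real (Suc n))"
        by metis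
      have UH: "U n \<in> H" and YH: "Y n \<in> H" for n
        using D(1,2)[OF UY] by auto
      have lim0: "(\<lambda>n. nrm (x - U n)) \<longlonglongrightarrow> 0"
        by (rule tendsto_sandwich[OF _ _ tendsto_const LIMSEQ_inverse_real_of_nat])
          (use U x UH in \<open>auto intro!: always_eventually intro: less_imp_le\<close>)
      have "\<exists>N. \<forall>m\<ge>N. \<forall>n\<ge>N. nrm (Y m - Y n) < e" if "e > 0" for e
      proof -
        have "\<forall>\<^sub>F n in sequentially. nrm (x - U n) < e / 2"
          using lim0 \<open>e > 0\<close> by (intro order_tendstoD(2)) auto
        then obtain N where N: "\<And>n. n \<ge> N \<Longrightarrow> nrm (x - U n) < e / 2"
          unfolding eventually_sequentially by blast
        have "nrm (Y m - Y n) < e" if "m \<ge> N" "n \<ge> N" for m n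
        proof -
          have "nrm (Y m - Y n) = nrm (U m - U n)"
            using D(7)[OF partial_conjugation_diff[OF G UY UY]] by simp
          also have "\<dots> \<le> nrm (U m - x) + nrm (x - U n)"
            by (rule nrm_triangle_diff) (use UH x in auto)
          finally show ?thesis
            using N[OF that(1)] N[OF that(2)] nrm_minus_commute[OF UH x, of m] by linarith
        qed
        then show ?thesis by blast
      qed
      then obtain y where y: "y \<in> H" and lim: "(\<lambda>n. nrm (Y n - y)) \<longlonglongrightarrow> 0"
        using complete[of Y] YH by blast
      have "(x, y) \<in> G"
      proof (rule G_closed[OF x y])
        fix e :: real assume "e > 0"
        then have "\<forall>\<^sub>F n in sequentially. nrm (x - U n) < e \<and> nrm (Y n - y) < e"
          using lim lim0 by (intro eventually_conj order_tendstoD(2)) auto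
        then obtain n where "nrm (x - U n) < e" "nrm (Y n - y) < e"
          unfolding eventually_sequentially by blast
        then show "\<exists>u w. (u, w) \<in> G \<and> nrm (x - u) < e \<and> nrm (y - w) < e"
          using UY nrm_minus_commute[OF YH y] by metis
      qed
      then show ?thesis by blast
    qed
  qed
  then have "\<forall>x\<in>H. \<exists>y. (x, y) \<in> G"
    by blast
  then obtain C where C: "\<And>x. x \<in> H \<Longrightarrow> (x, C x) \<in> G"
    by metis
  note CI = partial_conjugation_unique[OF G C]
  show thesis
  proof (rule that[of C])
    show "C x \<in> H" if "x \<in> H" for x using D(2)[OF C[OF that]] .
    then show "C (C x) = x" if "x \<in> H" for x
      using CI D(6)[OF C[OF that]] that by blast
    show "nrm (C x) = nrm x" if "x \<in> H" for x
      using D(7)[OF C[OF that]] by simp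
    show "C (x + y) = C x + C y" if "x \<in> H" "y \<in> H" for x y
      using CI D(4)[OF C C] that by blast
    show "C (c *\<^sub>C x) = cnj c *\<^sub>C C x" if "x \<in> H" for c x
      using CI D(5)[OF C] that by blast
    show "C (R x) = R' (C x)" if "x \<in> H" for x
      using CI D(8)[OF C] that by blast
  qed
qed

end


section \<open>Self-adjoint relations\<close>

text \<open>The equivalence says that \<open>T\<close> equals its own adjoint relation. Adjoint
  relations are linear and closed by their form, so these properties of \<open>T\<close> are read
  off from the right-hand side.\<close>

locale self_adjoint_relation = complex_hilbert +
  fixes T :: "('a \<times> 'a) set"
  assumes self_adjoint:
    "(x, y) \<in> T \<longleftrightarrow> x \<in> H \<and> y \<in> H \<and> (\<forall>u w. (u, w) \<in> T \<longrightarrow> ip w x = ip u y)"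
begin

lemma T_H: "(x, y) \<in> T \<Longrightarrow> x \<in> H" "(x, y) \<in> T \<Longrightarrow> y \<in> H"
  using self_adjoint[of x y] by blast+

lemma T_symmetric: "\<lbrakk>(x, y) \<in> T; (u, w) \<in> T\<rbrakk> \<Longrightarrow> ip w x = ip u y"
  using self_adjoint[of x y] by blast

lemma T_add:
  assumes a: "(x, y) \<in> T" and b: "(x', y') \<in> T"
  shows "(x + x', y + y') \<in> T"
proof (subst self_adjoint, intro conjI allI impI)
  show "ip w (x + x') = ip u (y + y')" if uw: "(u, w) \<in> T" for u w
    using T_H[OF a] T_H[OF b] T_H[OF uw] T_symmetric[OF a uw] T_symmetric[OF b uw]
    by (simp add: ip_add_right)
qed (use T_H[OF a] T_H[OF b] in auto)

lemma T_scale: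
  assumes a: "(x, y) \<in> T"
  shows "(c *\<^sub>C x, c *\<^sub>C y) \<in> T"
proof (subst self_adjoint, intro conjI allI impI)
  show "ip w (c *\<^sub>C x) = ip u (c *\<^sub>C y)" if uw: "(u, w) \<in> T" for u w
    using T_H[OF a] T_H[OF uw] T_symmetric[OF a uw] by (simp add: ip_scale_right)
qed (use T_H[OF a] in auto)

lemma T_diff: "\<lbrakk>(x, y) \<in> T; (x', y') \<in> T\<rbrakk> \<Longrightarrow> (x - x', y - y') \<in> T"
  using T_add[of x y "- x'" "- y'"] T_scale[of x' y' "- 1"] by simp

lemma T_closed:
  assumes xy: "x \<in> H" "y \<in> H"
    and near: "\<And>e. e > 0 \<Longrightarrow> \<exists>a b. (a, b) \<in> T \<and> nrm (x - a) < e \<and> nrm (y - b) < e"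
  shows "(x, y) \<in> T"
proof (subst self_adjoint, intro conjI xy allI impI)
  fix u w assume uw: "(u, w) \<in> T"
  have H: "u \<in> H" "w \<in> H"
    using T_H[OF uw] .
  \<comment> \<open>By Cauchy-Schwarz, errors below \<open>e / k\<close> in both components change
    the difference of the two inner products by at most \<open>e\<close>; the summand 1 makes
    \<open>k\<close> positive.\<close>
  define k where "k = nrm u + nrm w + 1"
  have k: "k > 0"
    using nrm_nonneg[OF H(1)] nrm_nonneg[OF H(2)] unfolding k_def by linarith
  have "cmod (ip w x - ip u y) \<le> 0 + e" if "e > 0" for e
  proof -
    obtain a b where ab: "(a, b) \<in> T" and d: "nrm (x - a) < e / k" "nrm (y - b) < e / k"
      using near[of "e / k"] k \<open>e > 0\<close> by auto
    note abH = T_H[OF ab]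
    have "ip w x - ip u y = ip w (x - a) - ip u (y - b)"
      using T_symmetric[OF ab uw] H xy abH by (simp add: ip_simps)
    also have "cmod \<dots> \<le> cmod (ip w (x - a)) + cmod (ip u (y - b))"
      by (rule norm_triangle_ineq4)
    also have "\<dots> \<le> nrm w * nrm (x - a) + nrm u * nrm (y - b)"
      by (intro add_mono Cauchy_Schwarz) (use H xy abH in auto)
    also have "\<dots> \<le> nrm w * (e / k) + nrm u * (e / k)"
      by (intro add_mono mult_left_mono) (use d H in auto)
    also have "\<dots> = (nrm w + nrm u) * (e / k)"
      by (rule distrib_right[symmetric])
    also have "\<dots> \<le> k * (e / k)"
      by (rule mult_right_mono) (use k \<open>e > 0\<close> in \<open>auto simp: k_def\<close>)
    finally show ?thesis
      using k by simp
  qed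
  then have "cmod (ip w x - ip u y) \<le> 0"
    by (rule field_le_epsilon)
  then show "ip w x = ip u y" by simp
qed

text \<open>Symmetry makes \<open>ip y x\<close> real, so the cross term with an imaginary unit has
  real part zero.\<close>

lemma nrm_shift:
  assumes xy: "(x, y) \<in> T" and c: "c = \<i> \<or> c = - \<i>"
  shows "(nrm (y - c *\<^sub>C x))\<^sup>2 = (nrm y)\<^sup>2 + (nrm x)\<^sup>2"
proof -
  note H = T_H[OF xy]
  have "Im (ip y x) = 0"
    using arg_cong[OF ip_commute[OF H(2,1)], of Im] T_symmetric[OF xy xy] by simp
  then have "Re (ip y (c *\<^sub>C x)) = 0"
    using c H by (auto simp: ip_scale_right)
  moreover have "nrm (c *\<^sub>C x) = nrm x"
    using c H by (auto simp: nrm_scale)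
  ultimately show ?thesis
    using H by (simp add: nrm_diff_sq)
qed

lemma nrm_le_shift:
  assumes "(x, y) \<in> T" "c = \<i> \<or> c = - \<i>"
  shows "nrm x \<le> nrm (y - c *\<^sub>C x)"
  by (rule power2_le_imp_le) (use nrm_shift[OF assms] T_H[OF assms(1)] in auto)

text \<open>The set is the range of T - c, so this is the basic criterion for self-adjointness: the
  lower bound from \<open>nrm_le_shift\<close> and closedness of \<open>T\<close> give a closed
  range, and a vector orthogonal to the range would be an eigenvector for a nonreal
  eigenvalue.\<close>

lemma range_shift:
  assumes c: "c = \<i> \<or> c = - \<i>"
  shows "{y - c *\<^sub>C x |x y. (x, y) \<in> T} = H" (is "?S = H")
proof (rule closed_subspace_eq_H)
  have SI: "y - c *\<^sub>C x \<in> ?S" if "(x, y) \<in> T" for x y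
    using that by blast
  have T0: "(0, 0) \<in> T"
  proof (subst self_adjoint, intro conjI allI impI)
    show "ip w 0 = ip u 0" if "(u, w) \<in> T" for u w
      using T_H[OF that] by simp
  qed auto
  show "subspace ?S"
    unfolding subspace_def
  proof (intro conjI ballI allI)
    show "0 \<in> ?S" using SI[OF T0] by simp
    show "p + q \<in> ?S" if "p \<in> ?S" "q \<in> ?S" for p q
    proof -
      from that obtain x y x' y' where "(x, y) \<in> T" "(x', y') \<in> T"
        and [simp]: "p = y - c *\<^sub>C x" "q = y' - c *\<^sub>C x'" by blast
      from SI[OF T_add[OF this(1,2)]] show ?thesis
        by (simp add: scale_right_distrib add_diff_add del: mem_Collect_eq)
    qed
    show "k *\<^sub>C p \<in> ?S" if "p \<in> ?S" for k p
    proof -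
      from that obtain x y where "(x, y) \<in> T" and [simp]: "p = y - c *\<^sub>C x" by blast
      from SI[OF T_scale[OF this(1), of k]] show ?thesis
        by (simp add: scale_right_diff_distrib mult.commute del: mem_Collect_eq)
    qed
  qed
  show "?S \<subseteq> H"
    by (auto dest: T_H)
  show "h = 0" if h: "h \<in> H" and orth: "\<And>s. s \<in> ?S \<Longrightarrow> ip h s = 0" for h
  proof -
    \<comment> \<open>Orthogonality to the range says
      \<open>ip w h = ip u (cnj c *\<^sub>C h)\<close> for every pair \<open>(u, w)\<close>, which
      is membership in the adjoint and hence in \<open>T\<close>. With
      \<open>y = cnj c *\<^sub>C h\<close>, the left side of \<open>nrm_shift\<close> is zero,
      forcing \<open>h = 0\<close>.\<close>
    have "(h, cnj c *\<^sub>C h) \<in> T"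
    proof (subst self_adjoint, intro conjI allI impI)
      fix u w assume uw: "(u, w) \<in> T"
      have "ip h (w - c *\<^sub>C u) = 0"
        using orth SI[OF uw] by blast
      then have "ip (w - c *\<^sub>C u) h = 0"
        using ip_commute[of h "w - c *\<^sub>C u"] h T_H[OF uw] by simp
      then show "ip w h = ip u (cnj c *\<^sub>C h)"
        using h T_H[OF uw] by (simp add: ip_simps)
    qed (use h in auto)
    from nrm_shift[OF this, of "cnj c"] have "(nrm (cnj c *\<^sub>C h))\<^sup>2 + (nrm h)\<^sup>2 = 0"
      using c by auto
    then show ?thesis
      using h nrm_eq_0_iff by (simp add: sum_power2_eq_zero_iff)
  qed
  show "h \<in> ?S" if h: "h \<in> H" and near: "\<And>e. e > 0 \<Longrightarrow> \<exists>s\<in>?S. nrm (h - s) < e" for h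
  proof -
    have "\<exists>x y. (x, y) \<in> T \<and> nrm (h - (y - c *\<^sub>C x)) < inverse (real (Suc n))" for n
      using near[of "inverse (real (Suc n))"] by auto
    then obtain X Y where XY: "\<And>n. (X n, Y n) \<in> T"
      and hn: "\<And>n. nrm (h - (Y n - c *\<^sub>C X n)) < inverse (real (Suc n))"
      by metis
    note XYH [simp] = T_H[OF XY]
    have lim0: "(\<lambda>n. nrm (h - (Y n - c *\<^sub>C X n))) \<longlonglongrightarrow> 0"
      by (rule tendsto_sandwich[OF _ _ tendsto_const LIMSEQ_inverse_real_of_nat])
        (use hn h in \<open>auto intro!: always_eventually intro: less_imp_le\<close>)
    have "\<exists>N. \<forall>m\<ge>N. \<forall>n\<ge>N. nrm (X m - X n) < e" if "e > 0" for e
    proof -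
      have "\<forall>\<^sub>F n in sequentially. nrm (h - (Y n - c *\<^sub>C X n)) < e / 2"
        using lim0 \<open>e > 0\<close> by (intro order_tendstoD(2)) auto
      then obtain N where N: "\<And>n. n \<ge> N \<Longrightarrow> nrm (h - (Y n - c *\<^sub>C X n)) < e / 2"
        unfolding eventually_sequentially by blast
      have "nrm (X m - X n) < e" if mn: "m \<ge> N" "n \<ge> N" for m n
      proof -
        have "nrm (X m - X n) \<le> nrm ((Y m - Y n) - c *\<^sub>C (X m - X n))"
          by (rule nrm_le_shift[OF T_diff[OF XY XY] c])
        also have "(Y m - Y n) - c *\<^sub>C (X m - X n) = (Y m - c *\<^sub>C X m) - (Y n - c *\<^sub>C X n)"
          by (simp add: scale_right_diff_distrib)
        also have "nrm \<dots> \<le> nrm ((Y m - c *\<^sub>C X m) - h) + nrm (h - (Y n - c *\<^sub>C X n))"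
          by (rule nrm_triangle_diff) (use h in auto)
        also have "nrm ((Y m - c *\<^sub>C X m) - h) = nrm (h - (Y m - c *\<^sub>C X m))"
          by (rule nrm_minus_commute) (use h in auto)
        finally show ?thesis
          using N[OF mn(1)] N[OF mn(2)] by linarith
      qed
      then show ?thesis by blast
    qed
    then obtain x where x: "x \<in> H" and lim: "(\<lambda>n. nrm (X n - x)) \<longlonglongrightarrow> 0"
      using complete[of X] XYH by blast
    \<comment> \<open>\<open>Y n\<close> is the sum of \<open>Y n - c *\<^sub>C X n\<close>, which
      tends to \<open>h\<close>, and \<open>c *\<^sub>C X n\<close>; closedness applies to the
      limits of both components.\<close>
    have "(x, h + c *\<^sub>C x) \<in> T"
    proof (rule T_closed)
      fix e :: real assume "e > 0"
      then have "\<forall>\<^sub>F n in sequentially. nrm (h - (Y n - c *\<^sub>C X n)) < e / 2 \<and> nrm (X n - x) < e / 2"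
        using lim lim0 by (intro eventually_conj order_tendstoD(2)) auto
      then obtain n where n: "nrm (h - (Y n - c *\<^sub>C X n)) < e / 2" "nrm (X n - x) < e / 2"
        unfolding eventually_sequentially by blast
      have xn: "nrm (x - X n) < e / 2"
        using n nrm_minus_commute[OF x XYH(1), of n] by simp
      have "h + c *\<^sub>C x - Y n = (h - (Y n - c *\<^sub>C X n)) + c *\<^sub>C (x - X n)"
        by (simp add: scale_right_diff_distrib algebra_simps)
      also have "nrm \<dots> \<le> nrm (h - (Y n - c *\<^sub>C X n)) + nrm (c *\<^sub>C (x - X n))"
        by (rule nrm_triangle) (use h x in auto)
      also have "nrm (c *\<^sub>C (x - X n)) = nrm (x - X n)"
        using c x by (auto simp: nrm_scale)
      finally have "nrm (h + c *\<^sub>C x - Y n) < e"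
        using n xn by linarith
      moreover have "nrm (x - X n) < e"
        using xn \<open>e > 0\<close> by simp
      ultimately show "\<exists>a b. (a, b) \<in> T \<and> nrm (x - a) < e \<and> nrm (h + c *\<^sub>C x - b) < e"
        using XY by blast
    qed (use h x in auto)
    from SI[OF this] show ?thesis
      by (simp del: mem_Collect_eq)
  qed
qed

section \<open>Resolvents at the imaginary units\<close>

text \<open>The value of (T - c)^(-1) at \<open>h\<close>: the equation T x - c x = h is stated as
  membership of a pair, since \<open>T\<close> is a relation.\<close>

definition resolvent :: "complex \<Rightarrow> 'a \<Rightarrow> 'a" where
  "resolvent c h = (THE x. (x, h + c *\<^sub>C x) \<in> T)"

lemma resolvent_unique:
  assumes "(x, h + c *\<^sub>C x) \<in> T" "(x', h + c *\<^sub>C x') \<in> T" "c = \<i> \<or> c = - \<i>"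
  shows "x = x'"
proof -
  have *: "(x - x', c *\<^sub>C (x - x')) \<in> T"
    using T_diff[OF assms(1,2)] by (simp add: scale_right_diff_distrib)
  have "nrm (x - x') = 0"
    using nrm_le_shift[OF * assms(3)] nrm_nonneg[OF T_H(1)[OF *]] by simp
  then show ?thesis
    using T_H(1)[OF *] by (simp add: nrm_eq_0_iff)
qed

lemma resolvent_in_T:
  assumes "h \<in> H" "c = \<i> \<or> c = - \<i>"
  shows "(resolvent c h, h + c *\<^sub>C resolvent c h) \<in> T"
proof -
  obtain x y where "(x, y) \<in> T" "h = y - c *\<^sub>C x"
    using assms range_shift[OF assms(2)] by blast
  then have "(x, h + c *\<^sub>C x) \<in> T" by simp
  then have "resolvent c h = x"
    unfolding resolvent_def using resolvent_unique[OF _ _ assms(2)] by blast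
  with \<open>(x, h + c *\<^sub>C x) \<in> T\<close> show ?thesis
    by simp
qed

lemma resolvent_eqI:
  assumes "(x, h + c *\<^sub>C x) \<in> T" "h \<in> H" "c = \<i> \<or> c = - \<i>"
  shows "resolvent c h = x"
  using resolvent_unique[OF resolvent_in_T] assms by blast

sublocale normal_contraction scale H ip "resolvent \<i>" "resolvent (- \<i>)"
proof
  fix x assume x: "x \<in> H"
  note R = resolvent_in_T[OF x, of \<i>, simplified] and R' = resolvent_in_T[OF x, of "- \<i>", simplified]
  show RH: "resolvent \<i> x \<in> H" and R'H: "resolvent (- \<i>) x \<in> H"
    using T_H R R' by blast+
  show "nrm (resolvent \<i> x) \<le> nrm x"
    using nrm_le_shift[OF R, of \<i>] by simp
  show "ip (resolvent \<i> x) y = ip x (resolvent (- \<i>) y)" if y: "y \<in> H" for y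
  proof -
    note S = resolvent_in_T[OF y, of "- \<i>", simplified]
    show ?thesis
      using T_symmetric[OF S R] T_H[OF S] x y RH by (simp add: ip_simps)
  qed
  define z where "z = resolvent \<i> (resolvent (- \<i>) x)"
  define r where "r = resolvent (- \<i>) x"
  have zr: "(z, r + \<i> *\<^sub>C z) \<in> T"
    using resolvent_in_T[OF R'H, of \<i>] by (simp add: z_def r_def)
  have r: "(r, x - \<i> *\<^sub>C r) \<in> T"
    using R' by (simp add: r_def)
  \<comment> \<open>the resolvent identity \<open>R - R' = 2 \<i> R R'\<close>\<close>
  define u where "u = r + (2 * \<i>) *\<^sub>C z"
  have u: "u = r + \<i> *\<^sub>C z + \<i> *\<^sub>C z"
    unfolding u_def by (metis add.assoc mult_2 scale_left_distrib)
  have "(u, (x - \<i> *\<^sub>C r) + (2 * \<i>) *\<^sub>C (r + \<i> *\<^sub>C z)) \<in> T"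
    unfolding u_def by (intro T_add r T_scale zr)
  also have "(x - \<i> *\<^sub>C r) + (2 * \<i>) *\<^sub>C (r + \<i> *\<^sub>C z) = x + \<i> *\<^sub>C u"
  proof -
    have "(2 * \<i>) *\<^sub>C r = \<i> *\<^sub>C r + \<i> *\<^sub>C r"
      by (metis mult_2 scale_left_distrib)
    moreover have "(2 * \<i>) *\<^sub>C \<i> *\<^sub>C z = \<i> *\<^sub>C \<i> *\<^sub>C z + \<i> *\<^sub>C \<i> *\<^sub>C z"
      by (metis mult_2 scale_left_distrib)
    ultimately show ?thesis
      unfolding u by (simp only: scale_right_distrib) (simp add: algebra_simps del: scale_scale)
  qed
  finally have "resolvent \<i> x = u"
    using x by (intro resolvent_eqI) auto
  \<comment> \<open>The second component \<open>r + \<i> *\<^sub>C z\<close> is also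
    \<open>u - \<i> *\<^sub>C z\<close>. The same pair thus exhibits \<open>z\<close> as the other
    resolvent applied to \<open>u\<close>, that is, to \<open>resolvent \<i> x\<close>.\<close>
  moreover have "(z, u + (- \<i>) *\<^sub>C z) \<in> T"
    using zr u by simp
  then have "resolvent (- \<i>) u = z"
    using T_H[OF zr] T_H[OF r] by (intro resolvent_eqI) (auto simp: u)
  ultimately show "resolvent \<i> (resolvent (- \<i>) x) = resolvent (- \<i>) (resolvent \<i> x)"
    by (simp add: z_def)
qed

text \<open>Every pair \<open>(x, y)\<close> of \<open>T\<close> comes from the resolvent at
  \<open>\<i>\<close>, applied to y - i x. Intertwining moves to the resolvent at
  \<open>- \<i>\<close>, and antilinearity turns -i into i on the conjugated side; the two sign
  changes cancel, leaving \<open>(C x, C y)\<close>.\<close>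

theorem commuting_conjugation_exists:
  obtains C where
    "\<And>x. x \<in> H \<Longrightarrow> C x \<in> H"
    "\<And>x. x \<in> H \<Longrightarrow> C (C x) = x"
    "\<And>x. x \<in> H \<Longrightarrow> nrm (C x) = nrm x"
    "\<And>x y. \<lbrakk>x \<in> H; y \<in> H\<rbrakk> \<Longrightarrow> C (x + y) = C x + C y"
    "\<And>c x. x \<in> H \<Longrightarrow> C (c *\<^sub>C x) = cnj c *\<^sub>C C x"
    "\<And>x y. (x, y) \<in> T \<Longrightarrow> (C x, C y) \<in> T"
proof (rule conjugation_exists)
  fix C assume H: "\<And>x. x \<in> H \<Longrightarrow> C x \<in> H"
    and C: "\<And>x. x \<in> H \<Longrightarrow> C (C x) = x" "\<And>x. x \<in> H \<Longrightarrow> nrm (C x) = nrm x"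
    and add: "\<And>x y. \<lbrakk>x \<in> H; y \<in> H\<rbrakk> \<Longrightarrow> C (x + y) = C x + C y"
    and scale: "\<And>c x. x \<in> H \<Longrightarrow> C (c *\<^sub>C x) = cnj c *\<^sub>C C x"
    and R: "\<And>x. x \<in> H \<Longrightarrow> C (resolvent \<i> x) = resolvent (- \<i>) (C x)"
  have "(C x, C y) \<in> T" if xy: "(x, y) \<in> T" for x y
  proof -
    note xyH = T_H[OF xy]
    define h where "h = y + (- \<i>) *\<^sub>C x"
    have h: "h \<in> H" using xyH by (auto simp: h_def)
    have "resolvent \<i> h = x"
      using xy h by (intro resolvent_eqI) (auto simp: h_def)
    then have "C x = resolvent (- \<i>) (C h)"
      using R[OF h] by simp
    then have "(C x, C h + (- \<i>) *\<^sub>C C x) \<in> T"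
      using resolvent_in_T[OF H[OF h], of "- \<i>"] by simp
    moreover have "C h = C y + \<i> *\<^sub>C C x"
      unfolding h_def using xyH by (subst add) (auto simp: scale simp del: scale_minus_left)
    ultimately show ?thesis by simp
  qed
  with H C add scale show thesis
    by (intro that[of C]) auto
qed

end


section \<open>The mean value inequality on the polydisk\<close>

lemma lborel_distr_orthogonal_cart:
  fixes T :: "real ^ 'm::{finite,wellorder} \<Rightarrow> real ^ 'm::_"
  assumes T: "orthogonal_transformation T"
  shows "distr lborel borel T = lborel"
proof (rule lborel_eqI[symmetric])
  have cont: "continuous_on UNIV T"
    using T by (simp add: linear_continuous_on linear_linear orthogonal_transformation_linear)
  then have [measurable]: "T \<in> borel_measurable borel"
    by (rule borel_measurable_continuous_onI)
  note T' = orthogonal_transformation_inv[OF T]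
  fix l u :: "real ^ 'm::_" assume lu: "\<And>b. b \<in> Basis \<Longrightarrow> l \<bullet> b \<le> u \<bullet> b"
  have img: "T -` box l u = inv T ` box l u"
    using T by (simp add: bij_vimage_eq_inv_image orthogonal_transformation_bij)
  have box: "box l u \<in> lmeasurable"
    by simp
  have lm: "T -` box l u \<in> lmeasurable"
    unfolding img by (rule measurable_orthogonal_image[OF T' box])
  have vim: "T -` box l u \<in> sets borel"
    using measurable_sets_borel[of T borel "box l u"] by simp
  have "emeasure (distr lborel borel T) (box l u) = emeasure lebesgue (T -` box l u)"
    using vim by (simp add: emeasure_distr)
  also have "\<dots> = ennreal (measure lebesgue (T -` box l u))"
    by (rule emeasure_eq_measure2[OF lm])
  also have "\<dots> = ennreal (measure lebesgue (box l u))"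
    unfolding img by (simp add: measure_orthogonal_image[OF T' box])
  also have "\<dots> = (\<Prod>b\<in>Basis. (u - l) \<bullet> b)"
    using lu by (simp add: measure_lborel_box_eq)
  finally show "emeasure (distr lborel borel T) (box l u) = (\<Prod>b\<in>Basis. (u - l) \<bullet> b)" .
qed simp

text \<open>Relabelling an orthonormal basis pulls boxes back to boxes with the same side lengths.
  The map transports Lebesgue measure between complex coordinate space and a real one of the same
  real dimension.\<close>

lemma lborel_distr_Basis_bij:
  fixes \<beta> \<phi> :: "'a::euclidean_space \<Rightarrow> 'b::euclidean_space"
  assumes \<beta>: "bij_betw \<beta> Basis Basis"
    and \<phi>_def: "\<phi> = (\<lambda>x. \<Sum>b\<in>Basis. (x \<bullet> b) *\<^sub>R \<beta> b)"
  shows "linear \<phi>" "b \<in> Basis \<Longrightarrow> \<phi> x \<bullet> \<beta> b = x \<bullet> b" "\<phi> x \<bullet> \<phi> y = x \<bullet> y"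
    "distr lborel borel \<phi> = lborel"
proof -
  show lin: "linear \<phi>"
    unfolding \<phi>_def
    by (intro linearI) (simp_all add: inner_left_distrib scaleR_left_distrib sum.distrib scaleR_right.sum)
  have \<beta>B: "\<beta> b \<in> Basis" if "b \<in> Basis" for b
    using \<beta> that by (rule bij_betw_apply)
  have \<beta>\<beta>: "\<beta> b \<bullet> \<beta> c = (if b = c then 1 else 0)" if "b \<in> Basis" "c \<in> Basis" for b c
    using \<beta> that \<beta>B by (auto simp: inner_Basis bij_betw_def inj_on_def)
  show coord: "\<phi> x \<bullet> \<beta> b = x \<bullet> b" if b: "b \<in> Basis" for x b
  proof -
    have "\<phi> x \<bullet> \<beta> b = (\<Sum>c\<in>Basis. if c = b then x \<bullet> c else 0)"
      unfolding \<phi>_def inner_sum_left by (rule sum.cong) (auto simp: \<beta>\<beta> b)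
    also have "\<dots> = x \<bullet> b"
      using b by simp
    finally show ?thesis .
  qed
  show "\<phi> x \<bullet> \<phi> y = x \<bullet> y"
  proof -
    have "\<phi> x \<bullet> \<phi> y = (\<Sum>c\<in>Basis. (\<phi> x \<bullet> c) * (\<phi> y \<bullet> c))"
      by (rule euclidean_inner)
    also have "\<dots> = (\<Sum>b\<in>Basis. (\<phi> x \<bullet> \<beta> b) * (\<phi> y \<bullet> \<beta> b))"
      using sum.reindex_bij_betw[OF \<beta>] by (rule sym)
    also have "\<dots> = x \<bullet> y"
      by (simp add: coord euclidean_inner[of x y])
    finally show ?thesis .
  qed
  have "continuous_on UNIV \<phi>"
    by (simp add: lin linear_continuous_on linear_linear)
  then have [measurable]: "\<phi> \<in> borel_measurable borel"
    by (rule borel_measurable_continuous_onI)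
  show "distr lborel borel \<phi> = lborel"
  proof (rule lborel_eqI[symmetric])
    fix l u :: 'b assume lu: "\<And>b. b \<in> Basis \<Longrightarrow> l \<bullet> b \<le> u \<bullet> b"
    define l' u' :: 'a where "l' = (\<Sum>b\<in>Basis. (l \<bullet> \<beta> b) *\<^sub>R b)" and "u' = (\<Sum>b\<in>Basis. (u \<bullet> \<beta> b) *\<^sub>R b)"
    have [simp]: "l' \<bullet> b = l \<bullet> \<beta> b" "u' \<bullet> b = u \<bullet> \<beta> b" if "b \<in> Basis" for b
      using that by (simp_all add: l'_def u'_def)
    have "\<phi> -` box l u = box l' u'"
    proof -
      have "\<phi> x \<in> box l u \<longleftrightarrow> (\<forall>b\<in>Basis. l \<bullet> \<beta> b < \<phi> x \<bullet> \<beta> b \<and> \<phi> x \<bullet> \<beta> b < u \<bullet> \<beta> b)" for x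
        unfolding mem_box by (subst bij_betw_imp_surj_on[OF \<beta>, symmetric]) (rule ball_simps)
      then show ?thesis
        by (auto simp: mem_box coord)
    qed
    then have "emeasure (distr lborel borel \<phi>) (box l u) = emeasure lborel (box l' u')"
      by (simp add: emeasure_distr)
    also have "\<dots> = (\<Prod>b\<in>Basis. (u - l) \<bullet> \<beta> b)"
      using lu \<beta>B by (simp add: inner_diff_left)
    also have "\<dots> = (\<Prod>b\<in>Basis. (u - l) \<bullet> b)"
      using prod.reindex_bij_betw[OF \<beta>, of "\<lambda>b. (u - l) \<bullet> b"] by simp
    finally show "emeasure (distr lborel borel \<phi>) (box l u) = (\<Prod>b\<in>Basis. (u - l) \<bullet> b)" .
  qed simp
qed

text \<open>The change of variables theorem of the library needs a well-ordered index type, and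
  \<open>'n bit0\<close> is one with \<open>2 * CARD('n)\<close> elements.\<close>

lemma lborel_distr_orthogonal:
  fixes T :: "complex ^ 'n \<Rightarrow> complex ^ 'n"
  assumes T: "orthogonal_transformation T"
  shows "distr lborel borel T = lborel"
proof -
  have "card (Basis :: (real ^ 'n bit0) set) = card (Basis :: (complex ^ 'n) set)"
    by simp
  then obtain \<beta> :: "real ^ 'n bit0 \<Rightarrow> complex ^ 'n" where \<beta>: "bij_betw \<beta> Basis Basis"
    using finite_same_card_bij[OF finite_Basis finite_Basis] by blast
  define \<gamma> where "\<gamma> = the_inv_into Basis \<beta>"
  have \<gamma>: "bij_betw \<gamma> Basis Basis"
    unfolding \<gamma>_def by (rule bij_betw_the_inv_into[OF \<beta>])
  define \<phi> where "\<phi> = (\<lambda>x. \<Sum>b\<in>Basis. (x \<bullet> b) *\<^sub>R \<beta> b)"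
  define \<psi> where "\<psi> = (\<lambda>x. \<Sum>b\<in>Basis. (x \<bullet> b) *\<^sub>R \<gamma> b)"
  note \<phi> = lborel_distr_Basis_bij[OF \<beta> \<phi>_def]
  note \<psi> = lborel_distr_Basis_bij[OF \<gamma> \<psi>_def]
  have \<phi>\<psi>: "\<phi> (\<psi> x) = x" for x
  proof (rule euclidean_eqI)
    fix c :: "complex ^ 'n" assume c: "c \<in> Basis"
    have "\<phi> (\<psi> x) \<bullet> \<beta> (\<gamma> c) = x \<bullet> c"
      using c \<gamma> \<phi>(2) \<psi>(2) by (simp add: bij_betw_apply)
    then show "\<phi> (\<psi> x) \<bullet> c = x \<bullet> c"
      using c \<beta> by (simp add: \<gamma>_def f_the_inv_into_f_bij_betw)
  qed
  have linT: "linear T" and ipT: "T x \<bullet> T y = x \<bullet> y" for x y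
    using T by (auto simp: orthogonal_transformation_def)
  have meas: "f \<in> borel_measurable borel" if "linear f" for f :: "'a::euclidean_space \<Rightarrow> 'b::euclidean_space"
    using that by (intro borel_measurable_continuous_onI) (simp add: linear_continuous_on linear_linear)
  note [measurable] = meas[OF \<phi>(1)] meas[OF \<psi>(1)] meas[OF linT]
  \<comment> \<open>This is \<open>T\<close> in real coordinates. Pushing Lebesgue measure forward
    along \<open>\<psi>\<close>, this map and \<open>\<phi>\<close> in turn amounts to pushing it
    along \<open>T\<close>.\<close>
  have "orthogonal_transformation (\<psi> \<circ> T \<circ> \<phi>)"
    unfolding orthogonal_transformation_def
    by (simp add: \<phi>(1,3) \<psi>(1,3) ipT linear_compose linT)
  then have "distr lborel borel (\<psi> \<circ> T \<circ> \<phi>) = lborel"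
    by (rule lborel_distr_orthogonal_cart)
  then have "distr (distr (distr lborel borel \<psi>) borel (\<psi> \<circ> T \<circ> \<phi>)) borel \<phi> = lborel"
    by (simp add: \<phi>(4) \<psi>(4))
  moreover have "\<phi> \<circ> (\<psi> \<circ> T \<circ> \<phi> \<circ> \<psi>) = T"
    by (auto simp: \<phi>\<psi>)
  ultimately show ?thesis
    by (simp add: distr_distr comp_assoc)
qed

section \<open>Holomorphy in several variables and restriction to complex lines\<close>

lemma open_polydisk: "open (polydisk :: (complex ^ 'n) set)"
proof -
  have "polydisk = (\<Inter>j. {z :: complex ^ 'n. cmod (z $ j) < 1})"
    by (auto simp: polydisk_def)
  also have "open \<dots>"
    by (intro open_INT ballI open_Collect_less continuous_intros) simp
  finally show ?thesis .
qed

lemma holomorphic_several_onE: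
  assumes "holomorphic_several_on h polydisk" "z \<in> polydisk"
  obtains h' where "(h has_derivative h') (at z)" "\<And>c v. h' (c *s v) = c * h' v"
  using assms at_within_open[OF assms(2) open_polydisk] unfolding holomorphic_several_on_def by metis

lemma continuous_on_holomorphic_several:
  "holomorphic_several_on h S \<Longrightarrow> continuous_on S h"
  unfolding holomorphic_several_on_def
  by (meson continuous_on_eq_continuous_within has_derivative_continuous)

lemma holomorphic_several_on_lincomb:
  assumes "holomorphic_several_on h S" "holomorphic_several_on k S"
  shows "holomorphic_several_on (\<lambda>z. a * h z + b * k z) S"
  unfolding holomorphic_several_on_def
proof
  fix z assume "z \<in> S"
  then obtain h' k' where d: "(h has_derivative h') (at z within S)" "(k has_derivative k') (at z within S)"
    and lin: "\<And>c v. h' (c *s v) = c * h' v" "\<And>c v. k' (c *s v) = c * k' v"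
    using assms unfolding holomorphic_several_on_def by metis
  have "((\<lambda>z. a * h z + b * k z) has_derivative (\<lambda>v. a * h' v + b * k' v)) (at z within S)"
    by (intro derivative_intros d)
  then show "\<exists>f'. ((\<lambda>z. a * h z + b * k z) has_derivative f') (at z within S) \<and> (\<forall>c v. f' (c *s v) = c * f' v)"
    by (intro exI[of _ "\<lambda>v. a * h' v + b * k' v"]) (simp add: lin algebra_simps)
qed

text \<open>The mean value inequality concerns the modulus of a holomorphic function; applied to a
  square it controls the integrand of the Bergman norm.\<close>

lemma holomorphic_several_on_square:
  assumes "holomorphic_several_on h S"
  shows "holomorphic_several_on (\<lambda>z. h z * h z) S"
  unfolding holomorphic_several_on_def
proof
  fix z assume "z \<in> S"
  then obtain h' where d: "(h has_derivative h') (at z within S)" and lin: "\<And>c v. h' (c *s v) = c * h' v"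
    using assms unfolding holomorphic_several_on_def by metis
  have "((\<lambda>z. h z * h z) has_derivative (\<lambda>v. h z * h' v + h' v * h z)) (at z within S)"
    by (intro derivative_intros d)
  then show "\<exists>f'. ((\<lambda>z. h z * h z) has_derivative f') (at z within S) \<and> (\<forall>c v. f' (c *s v) = c * f' v)"
    by (intro exI[of _ "\<lambda>v. h z * h' v + h' v * h z"]) (simp add: lin algebra_simps)
qed

lemma norm_vector_smult: "norm (c *s v) = cmod c * norm (v :: complex ^ 'n)"
  by (simp add: norm_vec_def norm_mult L2_set_right_distrib)

text \<open>Complex linearity of \<open>h'\<close> makes the real derivative along the line a
  multiplication by the number \<open>h' v\<close>.\<close>

lemma has_field_derivative_slice:
  fixes h :: "complex ^ 'n \<Rightarrow> complex"
  assumes h: "(h has_derivative h') (at (x + a *s v))" and lin: "\<And>c v. h' (c *s v) = c * h' v"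
  shows "((\<lambda>a. h (x + a *s v)) has_field_derivative h' v) (at a)"
proof -
  have "bounded_linear (\<lambda>c. c *s v)"
    by (rule bounded_linear_intro[of _ "norm v"])
      (simp_all add: vec_eq_iff algebra_simps norm_vector_smult)
  then have "((\<lambda>a. x + a *s v) has_derivative (\<lambda>c. 0 + c *s v)) (at a)"
    by (intro derivative_intros bounded_linear.has_derivative[of "\<lambda>c. c *s v"])
  from has_derivative_compose[OF this h] show ?thesis
    unfolding has_field_derivative_def by (simp add: lin mult_commute_abs)
qed

lemma holomorphic_on_slice:
  assumes "holomorphic_several_on h polydisk" "\<And>a. a \<in> S \<Longrightarrow> x + a *s v \<in> polydisk"
  shows "(\<lambda>a. h (x + a *s v)) holomorphic_on S"
  unfolding holomorphic_on_def field_differentiable_def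
proof
  fix a assume "a \<in> S"
  then obtain h' where "(h has_derivative h') (at (x + a *s v))" "\<And>c v. h' (c *s v) = c * h' v"
    using holomorphic_several_onE[OF assms(1) assms(2)] by metis
  from has_field_derivative_slice[OF this]
  show "\<exists>f'. ((\<lambda>a. h (x + a *s v)) has_field_derivative f') (at a within S)"
    using has_field_derivative_at_within by blast
qed

section \<open>Averages over circles and balls\<close>

text \<open>Cauchy's formula at the centre: with u = exp (2 pi i t), the form F(u) / u du becomes 2
  pi i F(u) dt, so \<open>F 0\<close> is an average over \<open>t\<close> in [0, 1]. The nonnegative
  integral is the form in which the order of integration is exchanged later.\<close>

lemma cmod_le_circle_average:
  assumes F: "F holomorphic_on cball 0 1"
  shows "ennreal (cmod (F 0)) \<le>
    (\<integral>\<^sup>+t. ennreal (cmod (F (exp (2 * of_real pi * \<i> * of_real t)))) * indicator {0..1} t \<partial>lborel)"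
proof -
  define e where "e = (\<lambda>t::real. exp (2 * of_real pi * \<i> * of_real t))"
  have e: "cmod (e t) = 1" for t
    by (simp add: e_def norm_exp_eq_Re)
  then have e0: "e t \<noteq> 0" for t
    by (metis norm_zero zero_neq_one)
  have "((\<lambda>u. F u / (u - 0)) has_contour_integral (2 * of_real pi * \<i> * F 0)) (circlepath 0 1)"
    using Cauchy_integral_circlepath_simple[OF F, of 0] by simp
  then have "((\<lambda>t. F (e t) / e t * (2 * of_real pi * \<i> * e t)) has_integral (2 * of_real pi * \<i> * F 0)) {0..1}"
    unfolding has_contour_integral vector_derivative_circlepath by (simp add: circlepath e_def)
  then have "((\<lambda>t. (2 * of_real pi * \<i>) * F (e t)) has_integral (2 * of_real pi * \<i>) * F 0) {0..1}"
    by (rule has_integral_eq[rotated]) (simp add: e0)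
  from has_integral_mult_right[OF this, of "inverse (2 * of_real pi * \<i>)"]
  have I: "((\<lambda>t. F (e t)) has_integral F 0) {0..1}"
    by (simp add: field_simps)
  have cont: "continuous_on {0..1} (\<lambda>t. F (e t))"
    by (rule continuous_on_compose2[OF holomorphic_on_imp_continuous_on[OF F]])
      (auto simp: e_def[abs_def] norm_exp_eq_Re intro!: continuous_intros)
  then have i: "(\<lambda>t. cmod (F (e t))) integrable_on {0..1}"
    by (intro integrable_continuous_interval continuous_intros)
  have "cmod (F 0) \<le> integral {0..1} (\<lambda>t. cmod (F (e t)))"
    using integral_norm_bound_integral[of "\<lambda>t. F (e t)" "{0..1}" "\<lambda>t. cmod (F (e t))"] I i
    by (auto simp: integral_unique)
  also have "ennreal (integral {0..1} (\<lambda>t. cmod (F (e t))))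
      = (\<integral>\<^sup>+t. ennreal (cmod (F (e t))) * indicator {0..1} t \<partial>lborel)"
    by (rule nn_integral_has_integral_lebesgue'[symmetric]) (use i in auto)
  finally show ?thesis
    by (simp add: e_def ennreal_leI)
qed

lemma orthogonal_transformation_smult:
  assumes "cmod c = 1"
  shows "orthogonal_transformation (\<lambda>v :: complex ^ 'n. c *s v)"
  unfolding orthogonal_transformation
  using assms by (auto simp: norm_vector_smult intro!: linearI simp: vec_eq_iff algebra_simps)

text \<open>Averaging over the circle \<open>w + e\<^sup>i\<^sup>t v\<close> costs nothing, because the ball is invariant under
  multiplication by unimodular numbers; on each slice Cauchy's formula applies.\<close>

lemma cmod_le_ball_average:
  fixes h :: "complex ^ 'n \<Rightarrow> complex"
  assumes h: "holomorphic_several_on h polydisk" and ball: "ball w r \<subseteq> polydisk"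
    and [measurable]: "h \<in> borel_measurable borel"
  shows "ennreal (cmod (h w)) * emeasure lborel (ball (0 :: complex ^ 'n) r)
    \<le> (\<integral>\<^sup>+z. ennreal (cmod (h z)) * indicator (ball w r) z \<partial>lborel)"
proof -
  define e where "e = (\<lambda>t::real. exp (2 * of_real pi * \<i> * of_real t))"
  have e: "cmod (e t) = 1" for t
    by (simp add: e_def norm_exp_eq_Re)
  have conte: "continuous_on UNIV e"
    unfolding e_def by (intro continuous_intros)
  define B where "B = ball (0 :: complex ^ 'n) r"
  have [measurable]: "B \<in> sets borel"
    by (simp add: B_def)
  have "continuous_on UNIV (\<lambda>p :: (complex ^ 'n) \<times> real. w + e (snd p) *s fst p)"
    by (intro continuous_intros continuous_on_vec_lambda continuous_on_compose2[OF conte]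
        | simp add: vector_scalar_mult_def)+
  then have "(\<lambda>p. w + e (snd p) *s fst p) \<in> borel_measurable (borel :: ((complex ^ 'n) \<times> real) measure)"
    by (rule borel_measurable_continuous_onI)
  then have [measurable]: "(\<lambda>p. w + e (snd p) *s fst p) \<in> borel_measurable (borel \<Otimes>\<^sub>M borel)"
    by (simp add: borel_prod)
  \<comment> \<open>Integrated over the angle first, \<open>g\<close> dominates the constant |h w|
    on the ball; integrated over the ball first, it loses its dependence on the angle. Being
    nonnegative, it needs only joint measurability for Tonelli.\<close>
  define g where "g = (\<lambda>p. ennreal (cmod (h (w + e (snd p) *s fst p))) * indicator B (fst p) * indicator {0..1} (snd p))"
  have g[measurable]: "g \<in> borel_measurable (borel \<Otimes>\<^sub>M borel)"
    unfolding g_def by measurable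
  have g': "g \<in> borel_measurable (lborel \<Otimes>\<^sub>M lborel)"
    using g by (simp cong: measurable_cong_sets sets_pair_measure_cong)
  have *: "ennreal (cmod (h w)) * indicator B v \<le> (\<integral>\<^sup>+t. g (v, t) \<partial>lborel)" for v
  proof (cases "v \<in> B")
    case True
    have "(\<lambda>a. h (w + a *s v)) holomorphic_on cball 0 1"
    proof (rule holomorphic_on_slice[OF h])
      fix a :: complex assume "a \<in> cball 0 1"
      then have "norm (a *s v) \<le> norm v"
        using mult_right_mono[of "cmod a" 1 "norm v"] by (simp add: norm_vector_smult)
      with True have "w + a *s v \<in> ball w r"
        by (simp add: B_def dist_norm norm_minus_commute)
      then show "w + a *s v \<in> polydisk"
        using ball by blast
    qed
    from cmod_le_circle_average[OF this] True show ?thesis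
      by (simp add: g_def e_def)
  qed simp
  have rot: "(\<integral>\<^sup>+v. g (v, t) \<partial>lborel)
      = (\<integral>\<^sup>+v. ennreal (cmod (h (w + v))) * indicator B v \<partial>lborel) * indicator {0..1} t" for t
  proof -
    have O: "orthogonal_transformation (\<lambda>v :: complex ^ 'n. e t *s v)"
      by (rule orthogonal_transformation_smult[OF e])
    have [measurable]: "(\<lambda>v :: complex ^ 'n. e t *s v) \<in> borel_measurable borel"
      using O
      by (intro borel_measurable_continuous_onI linear_continuous_on)
        (simp add: orthogonal_transformation_def linear_conv_bounded_linear)
    have "(\<integral>\<^sup>+v. ennreal (cmod (h (w + v))) * indicator B v \<partial>lborel)
        = (\<integral>\<^sup>+v. ennreal (cmod (h (w + v))) * indicator B v \<partial>distr lborel borel (\<lambda>v. e t *s v))"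
      unfolding lborel_distr_orthogonal[OF O] ..
    also have "\<dots> = (\<integral>\<^sup>+v. ennreal (cmod (h (w + e t *s v))) * indicator B (e t *s v) \<partial>lborel)"
      by (rule nn_integral_distr) measurable
    also have "(\<lambda>v. indicator B (e t *s v)) = (indicator B :: _ \<Rightarrow> ennreal)"
      by (auto simp: B_def indicator_def norm_vector_smult e)
    finally show ?thesis
      unfolding g_def by (simp add: nn_integral_multc)
  qed
  have "ennreal (cmod (h w)) * emeasure lborel B = (\<integral>\<^sup>+v. ennreal (cmod (h w)) * indicator B v \<partial>lborel)"
    by (simp add: nn_integral_cmult_indicator)
  also have "\<dots> \<le> (\<integral>\<^sup>+v. \<integral>\<^sup>+t. g (v, t) \<partial>lborel \<partial>lborel)"
    by (rule nn_integral_mono) (use * in blast)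
  also have "\<dots> = (\<integral>\<^sup>+t. \<integral>\<^sup>+v. g (v, t) \<partial>lborel \<partial>lborel)"
    by (rule lborel_pair.Fubini'[symmetric]) (use g' in \<open>simp add: split_def\<close>)
  also have "\<dots> = (\<integral>\<^sup>+v. ennreal (cmod (h (w + v))) * indicator B v \<partial>lborel)"
    unfolding rot by (subst nn_integral_cmult) auto
  also have "\<dots> = (\<integral>\<^sup>+v. ennreal (cmod (h (w + v))) * indicator (ball w r) (w + v) \<partial>lborel)"
    by (rule nn_integral_cong) (auto simp: B_def indicator_def dist_norm)
  also have "\<dots> = (\<integral>\<^sup>+z. ennreal (cmod (h z)) * indicator (ball w r) z \<partial>distr lborel borel ((+) w))"
    by (rule nn_integral_distr[symmetric]) (auto intro!: borel_measurable_times_ennreal borel_measurable_indicator)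
  finally show ?thesis
    unfolding lborel_distr_plus B_def .
qed


section \<open>Completeness of the Bergman space\<close>

abbreviation bergman_weight :: "('n::finite \<Rightarrow> nat) \<Rightarrow> complex ^ 'n \<Rightarrow> real" where
  "bergman_weight l z \<equiv> (\<Prod>j\<in>UNIV. (1 + real (l j)) * (1 - (cmod (z $ j))\<^sup>2) ^ l j * (1 / pi))"

lemma continuous_on_bergman_weight: "continuous_on S (bergman_weight l)"
  by (intro continuous_intros)

lemma bergman_weight_pos: "z \<in> polydisk \<Longrightarrow> 0 < bergman_weight l z"
  by (intro prod_pos) (auto simp: polydisk_def power_less_one_iff intro!: mult_pos_pos zero_less_power)

lemma bergman_density_measurable [measurable]:
  "(\<lambda>z. ennreal (indicator polydisk z * bergman_weight l z)) \<in> borel_measurable borel"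
proof -
  have [measurable]: "bergman_weight l \<in> borel_measurable borel"
    by (rule borel_measurable_continuous_onI[OF continuous_on_bergman_weight])
  have [measurable]: "(indicator polydisk :: complex ^ 'a \<Rightarrow> real) \<in> borel_measurable borel"
    by (intro borel_measurable_indicator borel_open open_polydisk)
  show ?thesis by measurable
qed

lemma sets_bergman_measure [simp, measurable_cong]: "sets (bergman_measure l) = sets borel"
  by (simp add: bergman_measure_def)

lemma bergman_spaceD:
  assumes "\<xi> \<in> bergman_space l"
  shows "holomorphic_several_on \<xi> polydisk" "z \<notin> polydisk \<Longrightarrow> \<xi> z = 0"
    "integrable (bergman_measure l) (\<lambda>z. (cmod (\<xi> z))\<^sup>2)"
  using assms by (auto simp: bergman_space_def)

lemma bergman_space_measurable: "\<xi> \<in> bergman_space l \<Longrightarrow> \<xi> \<in> borel_measurable borel"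
proof -
  assume \<xi>: "\<xi> \<in> bergman_space l"
  have "(\<lambda>z. indicator polydisk z *\<^sub>R \<xi> z) \<in> borel_measurable borel"
    by (intro borel_measurable_continuous_on_indicator borel_open open_polydisk
        continuous_on_holomorphic_several bergman_spaceD(1)[OF \<xi>])
  also have "(\<lambda>z. indicator polydisk z *\<^sub>R \<xi> z) = \<xi>"
    using bergman_spaceD(2)[OF \<xi>] by (auto simp: indicator_def)
  finally show ?thesis .
qed

lemma bergman_norm_sq: "(bergman_norm l \<xi>)\<^sup>2 = (LINT z|bergman_measure l. (cmod (\<xi> z))\<^sup>2)"
  by (simp add: bergman_norm_def)

lemma nn_integral_bergman_norm:
  "\<xi> \<in> bergman_space l \<Longrightarrow>
    (\<integral>\<^sup>+z. ennreal ((cmod (\<xi> z))\<^sup>2) \<partial>bergman_measure l) = ennreal ((bergman_norm l \<xi>)\<^sup>2)"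
  unfolding bergman_norm_sq by (rule nn_integral_eq_integral) (auto dest: bergman_spaceD(3))

lemma bergman_space_lincomb:
  assumes \<xi>: "\<xi> \<in> bergman_space l" and \<eta>: "\<eta> \<in> bergman_space l"
  shows "(\<lambda>z. a * \<xi> z + b * \<eta> z) \<in> bergman_space l"
proof -
  note [measurable] = bergman_space_measurable[OF \<xi>] bergman_space_measurable[OF \<eta>]
  have bound: "(cmod (a * \<xi> z + b * \<eta> z))\<^sup>2 \<le> 2 * (cmod a)\<^sup>2 * (cmod (\<xi> z))\<^sup>2 + 2 * (cmod b)\<^sup>2 * (cmod (\<eta> z))\<^sup>2" for z
  proof -
    have "(cmod (a * \<xi> z + b * \<eta> z))\<^sup>2 \<le> (cmod (a * \<xi> z) + cmod (b * \<eta> z))\<^sup>2"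
      by (intro power_mono norm_triangle_ineq) simp
    also have "\<dots> \<le> 2 * (cmod (a * \<xi> z))\<^sup>2 + 2 * (cmod (b * \<eta> z))\<^sup>2"
      using sum_squares_bound[of "cmod (a * \<xi> z)" "cmod (b * \<eta> z)"] by (simp add: power2_sum)
    finally show ?thesis
      by (simp add: norm_mult power_mult_distrib)
  qed
  have "integrable (bergman_measure l) (\<lambda>z. (cmod (a * \<xi> z + b * \<eta> z))\<^sup>2)"
  proof (rule Bochner_Integration.integrable_bound)
    show "integrable (bergman_measure l)
        (\<lambda>z. 2 * (cmod a)\<^sup>2 * (cmod (\<xi> z))\<^sup>2 + 2 * (cmod b)\<^sup>2 * (cmod (\<eta> z))\<^sup>2)"
      by (intro Bochner_Integration.integrable_add integrable_mult_right
          bergman_spaceD(3)[OF \<xi>] bergman_spaceD(3)[OF \<eta>])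
  qed (use bound in auto)
  then show ?thesis
    unfolding bergman_space_def
    using holomorphic_several_on_lincomb[OF bergman_spaceD(1)[OF \<xi>] bergman_spaceD(1)[OF \<eta>]]
      bergman_spaceD(2)[OF \<xi>] bergman_spaceD(2)[OF \<eta>] by auto
qed

lemma bergman_space_diff:
  "\<lbrakk>\<xi> \<in> bergman_space l; \<eta> \<in> bergman_space l\<rbrakk> \<Longrightarrow> (\<lambda>z. \<xi> z - \<eta> z) \<in> bergman_space l"
  using bergman_space_lincomb[of \<xi> l \<eta> 1 "- 1"] by simp

lemma bergman_space_0: "(\<lambda>z. 0) \<in> bergman_space l"
  unfolding bergman_space_def holomorphic_several_on_def
  by (auto intro!: exI[of _ "\<lambda>v. 0"])

section \<open>Locally uniform bounds on values and derivatives\<close>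

text \<open>Near \<open>z0\<close> the weight is at least some \<open>m > 0\<close>. The mean value
  inequality for the square of the function on a ball of volume \<open>V\<close> about
  \<open>w\<close> gives m V |xi(w)|^2 <= |xi|^2, whence the constant
  \<open>1 / sqrt (m * V)\<close>, uniform in \<open>w\<close>.\<close>

lemma bergman_point_bound:
  fixes l :: "'n::finite \<Rightarrow> nat"
  assumes z0: "z0 \<in> polydisk"
  obtains r C where "r > 0" "C > 0" "ball z0 r \<subseteq> polydisk"
    "\<And>\<xi> w. \<lbrakk>\<xi> \<in> bergman_space l; w \<in> ball z0 r\<rbrakk> \<Longrightarrow> cmod (\<xi> w) \<le> C * bergman_norm l \<xi>"
proof -
  obtain R where R: "R > 0" "cball z0 R \<subseteq> polydisk"
    using open_polydisk z0 open_contains_cball by blast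
  obtain y where y: "y \<in> cball z0 R"
    and y_min: "\<And>z. z \<in> cball z0 R \<Longrightarrow> bergman_weight l y \<le> bergman_weight l z"
    using continuous_attains_inf[OF compact_cball _ continuous_on_bergman_weight, of z0 R l] R by auto
  define m where "m = bergman_weight l y"
  have m: "m > 0"
    unfolding m_def using y R by (intro bergman_weight_pos) blast
  \<comment> \<open>With half the radius, the ball of radius \<open>r\<close> about any
    \<open>w\<close> in \<open>ball z0 r\<close> stays in \<open>cball z0 R\<close>, where the
    weight is bounded below.\<close>
  define r where "r = R / 2"
  have r: "r > 0" "ball z0 r \<subseteq> polydisk"
    using R by (auto simp: r_def subset_iff)
  define V where "V = measure lborel (ball (0 :: complex ^ 'n) r)"
  have V: "V > 0" "emeasure lborel (ball (0 :: complex ^ 'n) r) = ennreal V"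
  proof -
    show e: "emeasure lborel (ball (0 :: complex ^ 'n) r) = ennreal V"
      unfolding V_def by (rule emeasure_eq_ennreal_measure) (use emeasure_lborel_ball_finite[of "0 :: complex ^ 'n" r] in auto)
    have "emeasure lborel (ball (0 :: complex ^ 'n) r) \<noteq> 0"
    proof
      assume "emeasure lborel (ball (0 :: complex ^ 'n) r) = 0"
      then have "negligible (ball (0 :: complex ^ 'n) r)"
        by (simp add: negligible_iff_null_sets null_sets_def)
      then show False
        using r(1) open_not_negligible[of "ball (0 :: complex ^ 'n) r"] by auto
    qed
    with e show "V > 0"
      by (metis V_def ennreal_0 measure_nonneg order_le_less)
  qed
  have "cmod (\<xi> w) \<le> (1 / sqrt (m * V)) * bergman_norm l \<xi>"
    if \<xi>: "\<xi> \<in> bergman_space l" and w: "w \<in> ball z0 r" for \<xi> w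
  proof -
    note [measurable] = bergman_space_measurable[OF \<xi>]
    have "ball w r \<subseteq> cball z0 R"
    proof
      fix z assume "z \<in> ball w r"
      then show "z \<in> cball z0 R"
        using w dist_triangle[of z0 z w] by (simp add: r_def)
    qed
    then have sub: "ball w r \<subseteq> polydisk" and le: "\<And>z. z \<in> ball w r \<Longrightarrow> m \<le> bergman_weight l z"
      using R(2) y_min unfolding m_def by blast+
    have "ennreal (m * (V * (cmod (\<xi> w))\<^sup>2)) = ennreal m * (ennreal (cmod (\<xi> w * \<xi> w)) * emeasure lborel (ball (0 :: complex ^ 'n) r))"
      using m V(1) unfolding V(2) by (simp add: norm_mult power2_eq_square ac_simps flip: ennreal_mult)
    also have "\<dots> \<le> ennreal m * (\<integral>\<^sup>+z. ennreal (cmod (\<xi> z * \<xi> z)) * indicator (ball w r) z \<partial>lborel)"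
      by (intro mult_left_mono cmod_le_ball_average holomorphic_several_on_square
          bergman_spaceD(1)[OF \<xi>] sub) auto
    also have "\<dots> = (\<integral>\<^sup>+z. ennreal m * (ennreal (cmod (\<xi> z * \<xi> z)) * indicator (ball w r) z) \<partial>lborel)"
      by (rule nn_integral_cmult[symmetric])
        (auto intro!: borel_measurable_times_ennreal borel_measurable_indicator)
    also have "\<dots> \<le> (\<integral>\<^sup>+z. ennreal (indicator polydisk z * bergman_weight l z) * ennreal ((cmod (\<xi> z))\<^sup>2) \<partial>lborel)"
    proof (rule nn_integral_mono)
      fix z
      show "ennreal m * (ennreal (cmod (\<xi> z * \<xi> z)) * indicator (ball w r) z)
          \<le> ennreal (indicator polydisk z * bergman_weight l z) * ennreal ((cmod (\<xi> z))\<^sup>2)"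
      proof (cases "z \<in> ball w r")
        case True
        then have "ennreal m \<le> ennreal (indicator polydisk z * bergman_weight l z)"
          using sub le by (auto intro!: ennreal_leI)
        with True show ?thesis
          by (simp add: norm_mult power2_eq_square mult_right_mono)
      qed simp
    qed
    also have "\<dots> = (\<integral>\<^sup>+z. ennreal ((cmod (\<xi> z))\<^sup>2) \<partial>bergman_measure l)"
      unfolding bergman_measure_def by (rule nn_integral_density[symmetric]) measurable
    also have "\<dots> = ennreal ((bergman_norm l \<xi>)\<^sup>2)"
      by (rule nn_integral_bergman_norm[OF \<xi>])
    finally have "m * V * (cmod (\<xi> w))\<^sup>2 \<le> (bergman_norm l \<xi>)\<^sup>2"
      by (simp add: ennreal_le_iff mult.assoc)
    then have "sqrt (m * V * (cmod (\<xi> w))\<^sup>2) \<le> sqrt ((bergman_norm l \<xi>)\<^sup>2)"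
      by (rule real_sqrt_le_mono)
    then have "sqrt (m * V) * cmod (\<xi> w) \<le> bergman_norm l \<xi>"
      by (simp add: real_sqrt_mult bergman_norm_def)
    then show ?thesis
      using m V(1) by (simp add: field_simps)
  qed
  with r m V(1) show thesis
    by (intro that[of r "1 / sqrt (m * V)"]) auto
qed

text \<open>Cauchy's estimate on the complex line through \<open>x\<close> in direction
  \<open>v\<close>, which reduces the bound to one variable.\<close>

lemma derivative_bound:
  assumes h: "holomorphic_several_on h polydisk" and r: "r > 0" "ball x r \<subseteq> polydisk"
    and M: "\<And>z. z \<in> ball x r \<Longrightarrow> cmod (h z) \<le> M"
    and h': "(h has_derivative h') (at x)" and lin: "\<And>c v. h' (c *s v) = c * h' v"
  shows "cmod (h' v) \<le> 2 * M / r * norm v"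
proof (cases "v = 0")
  case True
  then show ?thesis
    using lin[of 0 0] by simp
next
  case False
  \<comment> \<open>The closed disk of radius \<open>s\<close> is mapped to distance at most
    \<open>r / 2\<close> from \<open>x\<close>, safely inside the open ball; this halving is the
    factor 2 in the bound.\<close>
  define s where "s = r / (2 * norm v)"
  have s: "s > 0" using r False by (simp add: s_def)
  have slice: "x + a *s v \<in> ball x r" if "a \<in> cball 0 s" for a
  proof -
    have "cmod a * norm v \<le> s * norm v"
      using that by (intro mult_right_mono) auto
    also have "\<dots> < r"
      using False r by (simp add: s_def)
    finally show ?thesis
      by (simp add: dist_norm norm_vector_smult)
  qed
  have hol: "(\<lambda>a. h (x + a *s v)) holomorphic_on cball 0 s"
    by (rule holomorphic_on_slice[OF h]) (use slice r in blast)
  have "norm ((deriv ^^ 1) (\<lambda>a. h (x + a *s v)) 0) \<le> fact 1 * M / s ^ 1"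
  proof (rule Cauchy_inequality)
    show "(\<lambda>a. h (x + a *s v)) holomorphic_on ball 0 s"
      by (rule holomorphic_on_subset[OF hol]) auto
    show "cmod (h (x + a *s v)) \<le> M" if "cmod (0 - a) = s" for a
      using that by (intro M slice) auto
  qed (use s holomorphic_on_imp_continuous_on[OF hol] in auto)
  moreover have "deriv (\<lambda>a. h (x + a *s v)) 0 = h' v"
    by (rule DERIV_imp_deriv, rule has_field_derivative_slice) (use h' lin in simp_all)
  ultimately show ?thesis
    by (simp add: s_def mult_ac)
qed

lemma bergman_space_complete:
  fixes X :: "nat \<Rightarrow> complex ^ 'n \<Rightarrow> complex"
  assumes X: "\<And>n. X n \<in> bergman_space l"
    and Cauchy_X: "\<And>e. e > 0 \<Longrightarrow> \<exists>N. \<forall>m\<ge>N. \<forall>n\<ge>N. bergman_norm l (\<lambda>z. X m z - X n z) < e"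
  obtains \<xi> where "\<xi> \<in> bergman_space l" "(\<lambda>n. bergman_norm l (\<lambda>z. X n z - \<xi> z)) \<longlonglongrightarrow> 0"
proof -
  have "\<forall>n. \<forall>x\<in>polydisk. \<exists>D. (X n has_derivative D) (at x) \<and> (\<forall>c v. D (c *s v) = c * D v)"
    using holomorphic_several_onE[OF bergman_spaceD(1)[OF X]] by metis
  then obtain D where D: "\<And>n x. x \<in> polydisk \<Longrightarrow> (X n has_derivative D n x) (at x)"
    and D_lin: "\<And>n x c v. x \<in> polydisk \<Longrightarrow> D n x (c *s v) = c * D n x v"
    by metis
  \<comment> \<open>The value 0 outside the polydisk is the convention for members of the Bergman
    space, and is also the pointwise limit there.\<close>
  define \<xi> where "\<xi> z = (if z \<in> polydisk then lim (\<lambda>n. X n z) else 0)" for z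
  have lim_\<xi>: "(\<lambda>n. X n z) \<longlonglongrightarrow> \<xi> z" for z
  proof (cases "z \<in> polydisk")
    case True
    obtain r C where rC: "r > 0" "C > 0"
      "\<And>\<xi> w. \<lbrakk>\<xi> \<in> bergman_space l; w \<in> ball z r\<rbrakk> \<Longrightarrow> cmod (\<xi> w) \<le> C * bergman_norm l \<xi>"
      using bergman_point_bound[OF True, of l] by metis
    have "Cauchy (\<lambda>n. X n z)"
    proof (rule CauchyI)
      fix e :: real assume "e > 0"
      then obtain N where N: "\<forall>m\<ge>N. \<forall>n\<ge>N. bergman_norm l (\<lambda>z. X m z - X n z) < e / C"
        using Cauchy_X[of "e / C"] rC(2) by auto
      have "cmod (X m z - X n z) < e" if "m \<ge> N" "n \<ge> N" for m n
      proof -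
        have "cmod (X m z - X n z) \<le> C * bergman_norm l (\<lambda>z. X m z - X n z)"
          using rC(3)[OF bergman_space_diff[OF X X]] rC(1) by simp
        also have "\<dots> < C * (e / C)"
          using N that rC(2) by (intro mult_strict_left_mono) auto
        finally show ?thesis
          using rC(2) by simp
      qed
      then show "\<exists>N. \<forall>m\<ge>N. \<forall>n\<ge>N. cmod (X m z - X n z) < e"
        by blast
    qed
    then show ?thesis
      using True by (simp add: \<xi>_def Cauchy_convergent_iff convergent_LIMSEQ_iff)
  next
    case False
    then show ?thesis
      using bergman_spaceD(2)[OF X] by (simp add: \<xi>_def)
  qed
  have hol: "holomorphic_several_on \<xi> polydisk"
    unfolding holomorphic_several_on_def
  proof
    fix z0 :: "complex ^ 'n" assume z0: "z0 \<in> polydisk"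
    obtain r C where rC: "r > 0" "C > 0" "ball z0 r \<subseteq> polydisk"
      "\<And>\<xi> w. \<lbrakk>\<xi> \<in> bergman_space l; w \<in> ball z0 r\<rbrakk> \<Longrightarrow> cmod (\<xi> w) \<le> C * bergman_norm l \<xi>"
      using bergman_point_bound[OF z0, of l] by metis
    define S where "S = ball z0 (r / 2)"
    have S: "open S" "convex S" "z0 \<in> S" "S \<subseteq> polydisk"
      using rC by (auto simp: S_def)
    \<comment> \<open>The derivative bound is applied on balls of radius \<open>r / 2\<close> about
      points of \<open>S\<close>, which stay in \<open>ball z0 r\<close>; the factor 4 is the
      product of this 2 with the 2 of that bound.\<close>
    have D_bound: "cmod (D m x v - D n x v) \<le> (4 * C / r) * bergman_norm l (\<lambda>z. X m z - X n z) * norm v"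
      if x: "x \<in> S" for m n x v
    proof -
      have sub: "ball x (r / 2) \<subseteq> ball z0 r"
      proof
        fix z assume "z \<in> ball x (r / 2)"
        then show "z \<in> ball z0 r"
          using x dist_triangle[of z0 z x] by (simp add: S_def)
      qed
      have x': "x \<in> polydisk" using x S by blast
      have "cmod (D m x v - D n x v) \<le> 2 * (C * bergman_norm l (\<lambda>z. X m z - X n z)) / (r / 2) * norm v"
      proof (rule derivative_bound)
        show "holomorphic_several_on (\<lambda>z. X m z - X n z) polydisk"
          by (rule bergman_spaceD(1)[OF bergman_space_diff[OF X X]])
        show "((\<lambda>z. X m z - X n z) has_derivative (\<lambda>v. D m x v - D n x v)) (at x)"
          by (intro derivative_intros D x')
        show "cmod (X m z - X n z) \<le> C * bergman_norm l (\<lambda>z. X m z - X n z)" if "z \<in> ball x (r / 2)" for z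
          using rC(4)[OF bergman_space_diff[OF X X]] sub that by blast
      qed (use rC sub x' in \<open>auto simp: D_lin algebra_simps\<close>)
      then show ?thesis by (simp add: mult_ac)
    qed
    have D_uniform: "\<exists>N. \<forall>m\<ge>N. \<forall>n\<ge>N. \<forall>x\<in>S. \<forall>v. cmod (D m x v - D n x v) \<le> e * norm v"
      if e: "e > 0" for e
    proof -
      obtain N where N: "\<forall>m\<ge>N. \<forall>n\<ge>N. bergman_norm l (\<lambda>z. X m z - X n z) < e / (4 * C / r)"
        using Cauchy_X[of "e / (4 * C / r)"] rC e by auto
      have "cmod (D m x v - D n x v) \<le> e * norm v" if mn: "m \<ge> N" "n \<ge> N" and x: "x \<in> S" for m n x v
      proof -
        have "(4 * C / r) * bergman_norm l (\<lambda>z. X m z - X n z) \<le> (4 * C / r) * (e / (4 * C / r))"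
          using N mn rC by (intro mult_left_mono) (auto intro: less_imp_le)
        also have "\<dots> = e"
          using rC by simp
        finally show ?thesis
          using D_bound[OF x, of m v n] by (meson mult_right_mono norm_ge_zero order_trans)
      qed
      then show ?thesis by blast
    qed
    define g' where "g' x v = lim (\<lambda>n. D n x v)" for x v
    have lim_D: "(\<lambda>n. D n x v) \<longlonglongrightarrow> g' x v" if x: "x \<in> S" for x v
    proof -
      have "Cauchy (\<lambda>n. D n x v)"
      proof (rule CauchyI)
        fix e :: real assume e: "e > 0"
        \<comment> \<open>Adding 1 covers \<open>v = 0\<close> and makes the final estimate
          strict.\<close>
        have "e / (norm v + 1) > 0"
          using e by (simp add: add_nonneg_pos)
        from D_uniform[OF this] obtain N
          where N: "\<And>m n. \<lbrakk>m \<ge> N; n \<ge> N\<rbrakk> \<Longrightarrow> cmod (D m x v - D n x v) \<le> e / (norm v + 1) * norm v"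
          using x by blast
        have "e / (norm v + 1) * norm v < e"
          using e by (simp add: pos_divide_less_eq add_nonneg_pos)
        with N show "\<exists>N. \<forall>m\<ge>N. \<forall>n\<ge>N. cmod (D m x v - D n x v) < e"
          by (meson order_le_less_trans)
      qed
      then show ?thesis
        by (simp add: g'_def Cauchy_convergent_iff convergent_LIMSEQ_iff)
    qed
    \<comment> \<open>Uniform convergence of derivatives on a convex set allows differentiation of
      the limit. The function obtained agrees with \<open>\<xi>\<close> on \<open>S\<close> by
      uniqueness of limits.\<close>
    have "\<exists>g. \<forall>x\<in>S. (\<lambda>n. X n x) \<longlonglongrightarrow> g x \<and> (g has_derivative g' x) (at x within S)"
    proof (rule has_derivative_sequence[OF S(2) _ _ S(3) lim_\<xi>])
      show "(X n has_derivative D n x) (at x within S)" if "x \<in> S" for n x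
        using D S that by (blast intro: has_derivative_at_withinI)
      show "\<forall>\<^sub>F n in sequentially. \<forall>x\<in>S. \<forall>h. cmod (D n x h - g' x h) \<le> e * norm h" if e: "e > 0" for e
      proof -
        obtain N where N: "\<And>m n x v. \<lbrakk>m \<ge> N; n \<ge> N; x \<in> S\<rbrakk> \<Longrightarrow> cmod (D m x v - D n x v) \<le> e * norm v"
          using D_uniform[OF e] by blast
        have "cmod (D n x h - g' x h) \<le> e * norm h" if n: "n \<ge> N" and x: "x \<in> S" for n x h
        proof (rule LIMSEQ_le_const2)
          show "(\<lambda>m. cmod (D n x h - D m x h)) \<longlonglongrightarrow> cmod (D n x h - g' x h)"
            by (intro tendsto_intros lim_D x)
        qed (use N n x in blast)
        then show ?thesis
          unfolding eventually_sequentially by blast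
      qed
    qed
    then obtain g where g: "\<And>x. x \<in> S \<Longrightarrow> (\<lambda>n. X n x) \<longlonglongrightarrow> g x"
      "\<And>x. x \<in> S \<Longrightarrow> (g has_derivative g' x) (at x within S)"
      by blast
    have "(g has_derivative g' z0) (at z0)"
      using g(2)[OF S(3)] at_within_open[OF S(3,1)] by simp
    then have "(\<xi> has_derivative g' z0) (at z0)"
      by (rule has_derivative_transform_within_open[OF _ S(1,3)])
        (use g(1) lim_\<xi> LIMSEQ_unique in blast)
    \<comment> \<open>Complex linearity passes from the derivatives \<open>D n z0\<close> to their
      pointwise limit.\<close>
    moreover have "g' z0 (c *s v) = c * g' z0 v" for c v
    proof (rule LIMSEQ_unique[OF lim_D[OF S(3)]])
      show "(\<lambda>n. D n z0 (c *s v)) \<longlonglongrightarrow> c * g' z0 v"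
        unfolding D_lin[OF z0] by (intro tendsto_intros lim_D S(3))
    qed
    ultimately show "\<exists>f'. (\<xi> has_derivative f') (at z0 within polydisk) \<and> (\<forall>c v. f' (c *s v) = c * f' v)"
      using has_derivative_at_withinI by blast
  qed
  have meas_X [measurable]: "X n \<in> borel_measurable borel" for n
    by (rule bergman_space_measurable[OF X])
  have meas_\<xi> [measurable]: "\<xi> \<in> borel_measurable borel"
    by (rule borel_measurable_LIMSEQ_metric[OF meas_X lim_\<xi>])
  have Fatou: "(\<integral>\<^sup>+z. ennreal ((cmod (X n z - \<xi> z))\<^sup>2) \<partial>bergman_measure l) \<le> ennreal (e\<^sup>2)"
    if N: "\<forall>m\<ge>N. \<forall>n\<ge>N. bergman_norm l (\<lambda>z. X m z - X n z) < e" and n: "n \<ge> N" for N n e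
  proof -
    have "(\<integral>\<^sup>+z. ennreal ((cmod (X n z - \<xi> z))\<^sup>2) \<partial>bergman_measure l)
        = (\<integral>\<^sup>+z. liminf (\<lambda>m. ennreal ((cmod (X n z - X m z))\<^sup>2)) \<partial>bergman_measure l)"
    proof (rule nn_integral_cong)
      fix z
      have "(\<lambda>m. ennreal ((cmod (X n z - X m z))\<^sup>2)) \<longlonglongrightarrow> ennreal ((cmod (X n z - \<xi> z))\<^sup>2)"
        by (intro tendsto_intros lim_\<xi> tendsto_ennrealI)
      then show "ennreal ((cmod (X n z - \<xi> z))\<^sup>2) = liminf (\<lambda>m. ennreal ((cmod (X n z - X m z))\<^sup>2))"
        by (rule lim_imp_Liminf[OF sequentially_bot, symmetric])
    qed
    also have "\<dots> \<le> liminf (\<lambda>m. \<integral>\<^sup>+z. ennreal ((cmod (X n z - X m z))\<^sup>2) \<partial>bergman_measure l)"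
      by (rule nn_integral_liminf) measurable
    \<comment> \<open>The Cauchy bound holds only for \<open>m \<ge> N\<close>, and an eventual
      bound suffices to control the upper limit.\<close>
    also have "\<dots> \<le> limsup (\<lambda>m. \<integral>\<^sup>+z. ennreal ((cmod (X n z - X m z))\<^sup>2) \<partial>bergman_measure l)"
      by (rule Liminf_le_Limsup) simp
    also have "\<dots> \<le> ennreal (e\<^sup>2)"
    proof (rule Limsup_bounded, unfold eventually_sequentially, intro exI allI impI)
      fix m assume "m \<ge> N"
      then have "bergman_norm l (\<lambda>z. X n z - X m z) \<le> e"
        using N n by (auto intro: less_imp_le)
      then have "(bergman_norm l (\<lambda>z. X n z - X m z))\<^sup>2 \<le> e\<^sup>2"
        by (rule power_mono) (simp add: bergman_norm_def)
      then show "(\<integral>\<^sup>+z. ennreal ((cmod (X n z - X m z))\<^sup>2) \<partial>bergman_measure l) \<le> ennreal (e\<^sup>2)"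
        unfolding nn_integral_bergman_norm[OF bergman_space_diff[OF X X]] by (rule ennreal_leI)
    qed
    finally show ?thesis .
  qed
  have diff: "(\<lambda>z. X n z - \<xi> z) \<in> bergman_space l"
    if N: "\<forall>m\<ge>N. \<forall>n\<ge>N. bergman_norm l (\<lambda>z. X m z - X n z) < e" and n: "n \<ge> N" for N n e
  proof -
    have "integrable (bergman_measure l) (\<lambda>z. (cmod (X n z - \<xi> z))\<^sup>2)"
    proof (rule integrableI_bounded)
      have "(\<integral>\<^sup>+z. ennreal (norm ((cmod (X n z - \<xi> z))\<^sup>2)) \<partial>bergman_measure l) \<le> ennreal (e\<^sup>2)"
        using Fatou[OF that] by simp
      then show "(\<integral>\<^sup>+z. ennreal (norm ((cmod (X n z - \<xi> z))\<^sup>2)) \<partial>bergman_measure l) < \<infinity>"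
        by (rule le_less_trans) simp
    qed measurable
    moreover have "holomorphic_several_on (\<lambda>z. X n z - \<xi> z) polydisk"
      using holomorphic_several_on_lincomb[OF bergman_spaceD(1)[OF X] hol, of 1 n "- 1"] by simp
    ultimately show ?thesis
      using bergman_spaceD(2)[OF X] by (auto simp: bergman_space_def \<xi>_def)
  qed
  obtain N where "\<forall>m\<ge>N. \<forall>n\<ge>N. bergman_norm l (\<lambda>z. X m z - X n z) < 1"
    using Cauchy_X[of 1] by auto
  then have "(\<lambda>z. X N z - \<xi> z) \<in> bergman_space l"
    by (rule diff) simp
  \<comment> \<open>Fatou controls only differences, so square integrability of \<open>\<xi>\<close>
    is recovered by subtracting \<open>X N - \<xi>\<close> from \<open>X N\<close>.\<close>
  from bergman_space_diff[OF X[of N] this] have \<xi>: "\<xi> \<in> bergman_space l"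
    by simp
  have "(\<lambda>n. bergman_norm l (\<lambda>z. X n z - \<xi> z)) \<longlonglongrightarrow> 0"
  proof (rule LIMSEQ_I)
    fix e :: real assume e: "e > 0"
    then obtain N where N: "\<forall>m\<ge>N. \<forall>n\<ge>N. bergman_norm l (\<lambda>z. X m z - X n z) < e / 2"
      using Cauchy_X[of "e / 2"] by auto
    have "bergman_norm l (\<lambda>z. X n z - \<xi> z) < e" if "n \<ge> N" for n
    proof -
      have "ennreal ((bergman_norm l (\<lambda>z. X n z - \<xi> z))\<^sup>2) \<le> ennreal ((e / 2)\<^sup>2)"
        using Fatou[OF N that] nn_integral_bergman_norm[OF bergman_space_diff[OF X \<xi>]] by simp
      then have "(bergman_norm l (\<lambda>z. X n z - \<xi> z))\<^sup>2 \<le> (e / 2)\<^sup>2"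
        by (simp add: ennreal_le_iff)
      then have "bergman_norm l (\<lambda>z. X n z - \<xi> z) \<le> e / 2"
        by (rule power2_le_imp_le) (use e in simp)
      with e show ?thesis by simp
    qed
    then show "\<exists>N. \<forall>n\<ge>N. norm (bergman_norm l (\<lambda>z. X n z - \<xi> z) - 0) < e"
      by (auto simp: bergman_norm_def)
  qed
  with \<xi> show thesis
    by (rule that)
qed

section \<open>The Bergman space as a Hilbert space\<close>

lemma bergman_inner_self: "bergman_inner l \<xi> \<xi> = of_real ((bergman_norm l \<xi>)\<^sup>2)"
  unfolding bergman_norm_sq bergman_inner_def
  by (simp add: complex_norm_square[symmetric] flip: integral_complex_of_real)

lemma nrm_bergman_inner:
  assumes "inner_product_subspace sc H (bergman_inner l)"
  shows "inner_product_subspace.nrm (bergman_inner l) \<xi> = bergman_norm l \<xi>"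
  by (simp add: inner_product_subspace.nrm_def[OF assms] bergman_inner_self)
    (simp add: bergman_norm_def)

lemma bergman_inner_integrable:
  assumes \<xi>: "\<xi> \<in> bergman_space l" and \<eta>: "\<eta> \<in> bergman_space l"
  shows "integrable (bergman_measure l) (\<lambda>z. \<xi> z * cnj (\<eta> z))"
proof (rule Bochner_Integration.integrable_bound)
  note [measurable] = bergman_space_measurable[OF \<xi>] bergman_space_measurable[OF \<eta>]
  show "integrable (bergman_measure l) (\<lambda>z. (cmod (\<xi> z))\<^sup>2 + (cmod (\<eta> z))\<^sup>2)"
    by (intro Bochner_Integration.integrable_add bergman_spaceD(3)[OF \<xi>] bergman_spaceD(3)[OF \<eta>])
  have [measurable]: "cnj \<in> borel_measurable borel"
    by (intro borel_measurable_continuous_onI continuous_intros)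
  show "(\<lambda>z. \<xi> z * cnj (\<eta> z)) \<in> borel_measurable (bergman_measure l)"
    by measurable
  have "cmod (\<xi> z) * cmod (\<eta> z) \<le> (cmod (\<xi> z))\<^sup>2 + (cmod (\<eta> z))\<^sup>2" for z
    using sum_squares_bound[of "cmod (\<xi> z)" "cmod (\<eta> z)"]
      mult_nonneg_nonneg[OF norm_ge_zero norm_ge_zero, of "\<xi> z" "\<eta> z"] by linarith
  then show "AE z in bergman_measure l. norm (\<xi> z * cnj (\<eta> z)) \<le> norm ((cmod (\<xi> z))\<^sup>2 + (cmod (\<eta> z))\<^sup>2)"
    by (simp add: norm_mult)
qed

text \<open>The point bound gives vanishing at every point rather than almost everywhere, so the
  inner product is definite on functions themselves and no quotient by null functions is
  taken.\<close>

lemma bergman_norm_eq_0: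
  assumes "\<xi> \<in> bergman_space l" "bergman_norm l \<xi> = 0"
  shows "\<xi> = (\<lambda>z. 0)"
proof
  fix z
  show "\<xi> z = 0"
  proof (cases "z \<in> polydisk")
    case True
    obtain r C where "r > 0" "\<And>\<xi> w. \<lbrakk>\<xi> \<in> bergman_space l; w \<in> ball z r\<rbrakk> \<Longrightarrow> cmod (\<xi> w) \<le> C * bergman_norm l \<xi>"
      using bergman_point_bound[OF True, of l] by metis
    from this(2)[OF assms(1), of z] this(1) show ?thesis
      using assms(2) by simp
  qed (use bergman_spaceD(2)[OF assms(1)] in blast)
qed

lemma complex_hilbert_bergman:
  "complex_hilbert (\<lambda>c \<xi> z. c * \<xi> z) (bergman_space l) (bergman_inner l)"
proof -
  interpret vector_space "\<lambda>c (\<xi> :: complex ^ 'a \<Rightarrow> complex) z. c * \<xi> z"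
    by standard (auto simp: fun_eq_iff algebra_simps)
  interpret inner_product_subspace "\<lambda>c (\<xi> :: complex ^ 'a \<Rightarrow> complex) z. c * \<xi> z" "bergman_space l" "bergman_inner l"
  proof
    show "subspace (bergman_space l)"
      unfolding subspace_def zero_fun_def plus_fun_def
    proof (intro conjI ballI allI)
      show "(\<lambda>z. 0) \<in> bergman_space l"
        by (rule bergman_space_0)
      show "(\<lambda>z. x z + y z) \<in> bergman_space l" if "x \<in> bergman_space l" "y \<in> bergman_space l" for x y
        using bergman_space_lincomb[OF that, of 1 1] by simp
      show "(\<lambda>z. c * x z) \<in> bergman_space l" if "x \<in> bergman_space l" for c x
        using bergman_space_lincomb[OF that that, of c 0] by simp
    qed
    fix x y z :: "complex ^ 'a \<Rightarrow> complex" and c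
    assume x: "x \<in> bergman_space l"
    show "bergman_inner l (x + y) z = bergman_inner l x z + bergman_inner l y z"
      if y: "y \<in> bergman_space l" and z: "z \<in> bergman_space l"
      unfolding bergman_inner_def
      using Bochner_Integration.integral_add[OF bergman_inner_integrable[OF x z] bergman_inner_integrable[OF y z]]
      by (simp add: distrib_right)
    show "bergman_inner l (\<lambda>z. c * x z) y = c * bergman_inner l x y"
      by (simp add: bergman_inner_def mult.assoc)
    show "bergman_inner l y x = cnj (bergman_inner l x y)"
      using Bochner_Integration.integral_cnj[of "bergman_measure l" "\<lambda>z. x z * cnj (y z)"]
      by (simp add: bergman_inner_def mult.commute)
    show "0 \<le> Re (bergman_inner l x x)"
      by (simp add: bergman_inner_self)
    show "x = 0" if "bergman_inner l x x = 0"
      using bergman_norm_eq_0[OF x] that by (simp add: bergman_inner_self zero_fun_def)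
  qed
  show ?thesis
  proof
    fix X :: "nat \<Rightarrow> complex ^ 'a \<Rightarrow> complex"
    assume X: "\<And>n. X n \<in> bergman_space l"
      and "\<And>e. e > 0 \<Longrightarrow> \<exists>N. \<forall>m\<ge>N. \<forall>n\<ge>N. nrm (X m - X n) < e"
    then have "\<And>e. e > 0 \<Longrightarrow> \<exists>N. \<forall>m\<ge>N. \<forall>n\<ge>N. bergman_norm l (\<lambda>z. X m z - X n z) < e"
      by (simp add: nrm_bergman_inner[OF inner_product_subspace_axioms] fun_diff_def)
    from bergman_space_complete[OF X this]
    show "\<exists>x\<in>bergman_space l. (\<lambda>n. nrm (X n - x)) \<longlonglongrightarrow> 0"
      by (auto simp: nrm_bergman_inner[OF inner_product_subspace_axioms] fun_diff_def)
  qed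
qed

section \<open>Adjoints in the Bergman space and complex symmetry\<close>

text \<open>Two adjoint values differ by a vector orthogonal to a dense domain. Uniqueness makes the
  definite description in \<open>adjoint_op\<close> denote an actual adjoint value.\<close>

lemma adjoint_value_unique:
  assumes dense: "densely_defined l W" and dom: "dom W \<subseteq> bergman_space l"
    and "is_adjoint_value l W \<eta> \<zeta>" "is_adjoint_value l W \<eta> \<zeta>'"
  shows "\<zeta> = \<zeta>'"
proof -
  interpret complex_hilbert "\<lambda>c (\<xi> :: complex ^ 'a \<Rightarrow> complex) z. c * \<xi> z" "bergman_space l" "bergman_inner l"
    by (rule complex_hilbert_bergman)
  note nrm = nrm_bergman_inner[OF inner_product_subspace_axioms]
  have H: "\<zeta> \<in> bergman_space l" "\<zeta>' \<in> bergman_space l"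
    using assms(3,4) by (auto simp: is_adjoint_value_def)
  define d where "d = \<zeta> - \<zeta>'"
  have d: "d \<in> bergman_space l"
    using H by (simp add: d_def)
  have orth: "bergman_inner l \<xi> d = 0" if "\<xi> \<in> dom W" for \<xi>
  proof -
    have "bergman_inner l \<xi> \<zeta> = bergman_inner l \<xi> \<zeta>'"
      using assms(3,4) that unfolding is_adjoint_value_def by metis
    moreover have "\<xi> \<in> bergman_space l"
      using that dom by blast
    ultimately show ?thesis
      using H by (simp add: d_def ip_diff_right)
  qed
  have "nrm d \<le> 0 + e" if e: "e > 0" for e
  proof -
    obtain \<xi> where \<xi>: "\<xi> \<in> dom W" and "bergman_norm l (\<lambda>z. d z - \<xi> z) < e"
      using dense d e unfolding densely_defined_def by blast
    then have near: "nrm (d - \<xi>) < e"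
      by (simp add: nrm fun_diff_def)
    have \<xi>H: "\<xi> \<in> bergman_space l" using \<xi> dom by blast
    \<comment> \<open>Subtracting \<open>\<xi>\<close>, which is orthogonal to \<open>d\<close>,
      does not change the inner product; Cauchy-Schwarz then bounds the norm of \<open>d\<close> by
      its distance to \<open>\<xi>\<close>.\<close>
    have "(nrm d)\<^sup>2 = Re (bergman_inner l (d - \<xi>) d)"
      using orth[OF \<xi>] d \<xi>H by (simp add: nrm_sq ip_diff_left)
    also have "\<dots> \<le> nrm (d - \<xi>) * nrm d"
      using complex_Re_le_cmod Cauchy_Schwarz[of "d - \<xi>" d] d \<xi>H order_trans by blast
    finally have "nrm d * nrm d \<le> nrm (d - \<xi>) * nrm d"
      by (simp add: power2_eq_square)
    then have "nrm d \<le> nrm (d - \<xi>) \<or> nrm d = 0"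
      using nrm_nonneg[OF d] mult_le_cancel_right[of "nrm d" "nrm d" "nrm (d - \<xi>)"] by linarith
    then show ?thesis using near e by linarith
  qed
  then have "nrm d \<le> 0"
    by (rule field_le_epsilon)
  then have "d = 0"
    using nrm_eq_0_iff[OF d] nrm_nonneg[OF d] by linarith
  then show ?thesis by (simp add: d_def)
qed

lemma adjoint_op_eq_Some_iff:
  assumes "densely_defined l W" "dom W \<subseteq> bergman_space l"
  shows "adjoint_op l W \<eta> = Some \<zeta> \<longleftrightarrow> \<eta> \<in> bergman_space l \<and> is_adjoint_value l W \<eta> \<zeta>"
proof -
  have "(THE \<zeta>. is_adjoint_value l W \<eta> \<zeta>) = \<zeta>" if "is_adjoint_value l W \<eta> \<zeta>" for \<zeta>
    using that adjoint_value_unique[OF assms] by blast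
  then show ?thesis
    unfolding adjoint_op_def by auto
qed

text \<open>Since W is its own adjoint, the claim becomes C W C = W. The conjugation maps the graph
  of W into itself, and being an involution it maps it onto itself, which also matches the
  domains.\<close>

lemma real_symmetric_imp_complex_symmetric:
  assumes lin: "linear_operator l W" and sym: "real_symmetric l W"
  shows "complex_symmetric l W"
proof -
  have dom: "dom W \<subseteq> bergman_space l"
    using lin by (simp add: linear_operator_def)
  have dense: "densely_defined l W" and adj: "adjoint_op l W = W"
    using sym by (simp_all add: real_symmetric_def)
  interpret complex_hilbert "\<lambda>c (\<xi> :: complex ^ 'a \<Rightarrow> complex) z. c * \<xi> z" "bergman_space l" "bergman_inner l"
    by (rule complex_hilbert_bergman)
  note nrm = nrm_bergman_inner[OF inner_product_subspace_axioms]
  define T where "T = {(\<xi>, \<eta>). W \<xi> = Some \<eta>}"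
  have T: "(\<xi>, \<eta>) \<in> T \<longleftrightarrow> W \<xi> = Some \<eta>" for \<xi> \<eta>
    by (simp add: T_def)
  interpret self_adjoint_relation "\<lambda>c (\<xi> :: complex ^ 'a \<Rightarrow> complex) z. c * \<xi> z" "bergman_space l" "bergman_inner l" T
  proof
    fix x y
    have "(x, y) \<in> T \<longleftrightarrow> x \<in> bergman_space l \<and> is_adjoint_value l W x y"
      using adjoint_op_eq_Some_iff[OF dense dom, of x y] by (simp add: adj T)
    also have "\<dots> \<longleftrightarrow> x \<in> bergman_space l \<and> y \<in> bergman_space l \<and>
        (\<forall>u w. (u, w) \<in> T \<longrightarrow> bergman_inner l w x = bergman_inner l u y)"
      by (auto simp: is_adjoint_value_def T dom_def)
    finally show "(x, y) \<in> T \<longleftrightarrow> x \<in> bergman_space l \<and> y \<in> bergman_space l \<and>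
        (\<forall>u w. (u, w) \<in> T \<longrightarrow> bergman_inner l w x = bergman_inner l u y)" .
  qed
  obtain C where CH: "\<And>x. x \<in> bergman_space l \<Longrightarrow> C x \<in> bergman_space l"
    and CC: "\<And>x. x \<in> bergman_space l \<Longrightarrow> C (C x) = x"
    and Cn: "\<And>x. x \<in> bergman_space l \<Longrightarrow> nrm (C x) = nrm x"
    and Ca: "\<And>x y. \<lbrakk>x \<in> bergman_space l; y \<in> bergman_space l\<rbrakk> \<Longrightarrow> C (x + y) = C x + C y"
    and Cs: "\<And>c x. x \<in> bergman_space l \<Longrightarrow> C (\<lambda>z. c * x z) = (\<lambda>z. cnj c * C x z)"
    and CT: "\<And>x y. (x, y) \<in> T \<Longrightarrow> (C x, C y) \<in> T"
    by (rule commuting_conjugation_exists) blast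
  have "conjugation l C"
    unfolding conjugation_def
  proof (intro conjI ballI allI)
    fix x y :: "complex ^ 'a \<Rightarrow> complex" and a b
    assume x: "x \<in> bergman_space l"
    show "C x \<in> bergman_space l" "C (C x) = x" "bergman_norm l (C x) = bergman_norm l x"
      using x CH CC Cn nrm by auto
    assume y: "y \<in> bergman_space l"
    have "C ((\<lambda>z. a * x z) + (\<lambda>z. b * y z)) = C (\<lambda>z. a * x z) + C (\<lambda>z. b * y z)"
      using x y by (intro Ca) auto
    then show "C (\<lambda>z. a * x z + b * y z) = (\<lambda>z. cnj a * C x z + cnj b * C y z)"
      using x y by (simp add: Cs plus_fun_def)
  qed
  moreover have "W = conjugate_op l C (adjoint_op l W)"
  proof
    fix x
    show "W x = conjugate_op l C (adjoint_op l W) x"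
    proof (cases "x \<in> bergman_space l")
      case False
      then show ?thesis
        using dom by (auto simp: conjugate_op_def)
    next
      case True
      show ?thesis
      proof (cases "W x")
        case None
        \<comment> \<open>Otherwise applying \<open>C\<close> again would put
          \<open>x = C (C x)\<close> into the domain of \<open>W\<close>.\<close>
        have "W (C x) = None"
        proof (rule ccontr)
          assume "W (C x) \<noteq> None"
          then obtain y where "(C x, y) \<in> T"
            by (auto simp: T)
          from CT[OF this] show False
            using CC[OF True] None by (simp add: T)
        qed
        then show ?thesis
          using None by (simp add: conjugate_op_def adj)
      next
        case (Some y)
        then have xy: "(x, y) \<in> T" by (simp add: T)
        then show ?thesis
          using Some CT[OF xy] CC T_H(2)[OF xy] True by (simp add: conjugate_op_def adj T)
      qed
    qed
  qed
  ultimately show ?thesis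
    using dense by (auto simp: complex_symmetric_def)
qed

theorem corollary5p4:
  fixes l :: "'n::finite \<Rightarrow> nat"
    and f :: "complex ^ 'n \<Rightarrow> complex"
    and g :: "complex ^ 'n \<Rightarrow> complex ^ 'n"
    and W :: "'n partial_op"
  assumes "holomorphic_several_on f polydisk"
    and "\<And>j. holomorphic_several_on (\<lambda>z. g z $ j) polydisk"
    and "g ` polydisk \<subseteq> polydisk"
    and "linear_operator l W"
    and "W \<subseteq>\<^sub>m W_max l f g"
    and "real_symmetric l W"
  shows "complex_symmetric l W"
  using assms(4,6) by (rule real_symmetric_imp_complex_symmetric)

end
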